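(* We have the following equality of bigraded subspaces of $\mathfrak{Lie}(X)$: \[ \mathfrak{stab}_{\mathfrak{Lie}(X)}(\Delta_Y)=\mathfrak{ls}\oplus\mathbb{Q}x_0\oplus\mathbb{Q}x_1 . \]
   Context: Let $\mathbb{Q}\langle X\rangle$ be the free associative $\mathbb{Q}$-algebra on $X=\{x_0,x_1\}$, with coproduct $\Delta_X$ the algebra morphism given by $\Delta_X(x_i)=x_i\otimes1+1\otimes x_i$. Let $\mathfrak{Lie}(X)$ be the free Lie algebra on $X$, identified with the set of $\Delta_X$-primitive elements of $\mathbb{Q}\langle X\rangle$; it is bigraded by weight and depth, with $x_0$ of bidegree $(1,0)$ and $x_1$ of bidegree $(1,1)$. Let $\mathbb{Q}\langle Y\rangle$ be the free associative algebra on $Y=\{y_1,y_2,\dots\}$ with coproduct $\Delta_Y$ the algebra morphism with $\Delta_Y(y_n)=y_n\otimes1+1\otimes y_n$, and let $\mathfrak{Lie}(Y)$ be its set of $\Delta_Y$-primitive elements. Identify $\mathbb{Q}\langle Y\rangle$ with a subalgebra of $\mathbb{Q}\langle X\rangle$ via the injective algebra morphism $y_n\mapsto x_0^{n-1}x_1$. Let $\pi_Y:\mathbb{Q}\langle X\rangle\to\mathbb{Q}\langle Y\rangle$ be the linear map sending $x_0^{k_1-1}x_1\cdots x_0^{k_d-1}x_1x_0^r$ to $y_{k_1}\cdots y_{k_d}$ if $r=0$ and to $0$ if $r>0$. For a word $w$, $(\psi\mid w)$ denotes the coefficient of $w$ in $\psi$. For $\psi\in\mathbb{Q}\langle X\rangle$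 let $d_\psi$ be the derivation of $\mathbb{Q}\langle X\rangle$ with $d_\psi(x_0)=0$, $d_\psi(x_1)=[x_1,\psi]$. The Ihara bracket $\{\psi_1,\psi_2\}=d_{\psi_1}(\psi_2)-d_{\psi_2}(\psi_1)+[\psi_1,\psi_2]$ is a Lie bracket on $\mathfrak{Lie}(X)$. For $\psi\in\mathfrak{Lie}(X)$ put $s_\psi=\ell_\psi+d_\psi$ where $\ell_\psi$ is left multiplication by $\psi$; $s_\psi$ maps $\mathbb{Q}\langle X\rangle x_0$ into itself, so there is a unique linear map $s^Y_\psi:\mathbb{Q}\langle Y\rangle\to\mathbb{Q}\langle Y\rangle$ with $\pi_Y\circ s_\psi=s^Y_\psi\circ\pi_Y$. Define $\mathfrak{stab}_{\mathfrak{Lie}(X)}(\Delta_Y)=\{\psi\in\mathfrak{Lie}(X)\mid (s^Y_\psi\otimes\mathrm{id}+\mathrm{id}\otimes s^Y_\psi)\circ\Delta_Y=\Delta_Y\circ s^Y_\psi\}$. Let $\mathfrak{ls}$ be the set of $\psi\in\mathbb{Q}\langle X\rangle$ such that (i) $(\psi\mid x_i)=0$ for $i=0,1$; (ii) $\Delta_X(\psi)=\psi\otimes1+1\otimes\psi$; (iii) $\Delta_Y(\pi_Y(\psi))=\pi_Y(\psi)\otimes1+1\otimes\pi_Y(\psi)$; (iv) $(\psi\mid x_0^{n-1}x_1)=0$ for all even $n\ge2$. *)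

theory Defs
  imports "HOL-Library.Poly_Mapping" "HOL-Library.Product_Plus" Complex_Main
begin

section \<open>Free associative algebras over the rationals\<close>

text \<open>
  Lists form the free monoid under concatenation, so the convolution product of
  \<^theory>\<open>HOL-Library.Poly_Mapping\<close> turns \<open>'a list \<Rightarrow>\<^sub>0 rat\<close> into the free associative algebra
  on \<open>'a\<close>, and \<open>('a list \<times> 'a list) \<Rightarrow>\<^sub>0 rat\<close> (with the componentwise monoid structure on
  pairs) into its tensor square: the pair \<open>(u, v)\<close> is the basis element $u \otimes v$.
\<close>

instantiation list :: (type) monoid_add
begin

definition zero_list :: "'a list" where "zero_list = []"
definition plus_list :: "'a list \<Rightarrow> 'a list \<Rightarrow> 'a list" where "plus_list = append"

instance by standard (simp_all add: zero_list_def plus_list_def)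

end

type_synonym 'a falg = "'a list \<Rightarrow>\<^sub>0 rat"
type_synonym 'a falg2 = "('a list \<times> 'a list) \<Rightarrow>\<^sub>0 rat"

definition qscale :: "rat \<Rightarrow> ('k \<Rightarrow>\<^sub>0 rat) \<Rightarrow> ('k \<Rightarrow>\<^sub>0 rat)" (infixr \<open>*\<^sub>Q\<close> 75) where
  "c *\<^sub>Q p = Poly_Mapping.map ((*) c) p"

lemma lookup_qscale [simp]: "Poly_Mapping.lookup (c *\<^sub>Q p) k = c * Poly_Mapping.lookup p k"
  by (simp add: qscale_def Poly_Mapping.map.rep_eq when_def)

interpretation QV: vector_space qscale
  by standard (auto intro!: poly_mapping_eqI simp: lookup_add algebra_simps)

abbreviation qlinear :: "(('k \<Rightarrow>\<^sub>0 rat) \<Rightarrow> ('l \<Rightarrow>\<^sub>0 rat)) \<Rightarrow> bool" where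
  "qlinear f \<equiv> Vector_Spaces.linear qscale qscale f"

abbreviation mon :: "'k \<Rightarrow> ('k \<Rightarrow>\<^sub>0 rat)" where
  "mon w \<equiv> Poly_Mapping.single w 1"

definition lin_ext :: "('k \<Rightarrow> ('l \<Rightarrow>\<^sub>0 rat)) \<Rightarrow> ('k \<Rightarrow>\<^sub>0 rat) \<Rightarrow> ('l \<Rightarrow>\<^sub>0 rat)" where
  "lin_ext f p = (\<Sum>w\<in>Poly_Mapping.keys p. Poly_Mapping.lookup p w *\<^sub>Q f w)"

definition alg_ext :: "('a \<Rightarrow> ('k::monoid_add \<Rightarrow>\<^sub>0 rat)) \<Rightarrow> 'a falg \<Rightarrow> ('k \<Rightarrow>\<^sub>0 rat)" where
  "alg_ext f = lin_ext (\<lambda>w. prod_list (map f w))"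

fun der_word :: "('a \<Rightarrow> 'a falg) \<Rightarrow> 'a list \<Rightarrow> 'a falg" where
  "der_word f [] = 0"
| "der_word f (a # w) = f a * mon w + mon [a] * der_word f w"

definition der_ext :: "('a \<Rightarrow> 'a falg) \<Rightarrow> 'a falg \<Rightarrow> 'a falg" where
  "der_ext f = lin_ext (der_word f)"

definition tensor :: "'a falg \<Rightarrow> 'a falg \<Rightarrow> 'a falg2" (infixl \<open>\<otimes>\<^sub>Q\<close> 70) where
  "p \<otimes>\<^sub>Q q = (\<Sum>u\<in>Poly_Mapping.keys p. \<Sum>v\<in>Poly_Mapping.keys q. Poly_Mapping.single (u, v) (Poly_Mapping.lookup p u * Poly_Mapping.lookup q v))"

definition tensor_map :: "('a falg \<Rightarrow> 'a falg) \<Rightarrow> ('a falg \<Rightarrow> 'a falg) \<Rightarrow> 'a falg2 \<Rightarrow> 'a falg2" where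
  "tensor_map f g = lin_ext (\<lambda>(u, v). f (mon u) \<otimes>\<^sub>Q g (mon v))"

definition coprod :: "'a falg \<Rightarrow> 'a falg2" where
  "coprod = alg_ext (\<lambda>a. mon [a] \<otimes>\<^sub>Q 1 + 1 \<otimes>\<^sub>Q mon [a])"

definition primitives :: "'a falg set" where
  "primitives = {p. coprod p = p \<otimes>\<^sub>Q 1 + 1 \<otimes>\<^sub>Q p}"

subsection \<open>These extensions have the expected universal properties\<close>

lemma lin_ext_superset:
  assumes "finite A" "Poly_Mapping.keys p \<subseteq> A"
  shows "lin_ext f p = (\<Sum>w\<in>A. Poly_Mapping.lookup p w *\<^sub>Q f w)"
  unfolding lin_ext_def using assms
  by (intro sum.mono_neutral_left) (auto simp: in_keys_iff)

lemma lin_ext_add: "lin_ext f (p + q) = lin_ext f p + lin_ext f q"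
proof -
  have fin: "finite (Poly_Mapping.keys p \<union> Poly_Mapping.keys q)" by simp
  have "Poly_Mapping.keys (p + q) \<subseteq> Poly_Mapping.keys p \<union> Poly_Mapping.keys q" by (rule keys_add)
  then show ?thesis
    by (simp add: lin_ext_superset[OF fin] lookup_add QV.scale_left_distrib sum.distrib)
qed

lemma lin_ext_scale: "lin_ext f (c *\<^sub>Q p) = c *\<^sub>Q lin_ext f p"
proof -
  have "Poly_Mapping.keys (c *\<^sub>Q p) \<subseteq> Poly_Mapping.keys p" by (auto simp: in_keys_iff)
  then have "lin_ext f (c *\<^sub>Q p) = (\<Sum>w\<in>Poly_Mapping.keys p. Poly_Mapping.lookup (c *\<^sub>Q p) w *\<^sub>Q f w)"
    by (intro lin_ext_superset) auto
  then show ?thesis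
    by (simp add: lin_ext_def QV.scale_sum_right)
qed

lemma linear_lin_ext: "qlinear (lin_ext f)"
  by (rule Vector_Spaces.linear.intro; unfold_locales) (simp_all add: lin_ext_add lin_ext_scale)

lemma lin_ext_mon [simp]: "lin_ext f (mon w) = f w"
  by (simp add: lin_ext_def)

lemma lin_ext_zero [simp]: "lin_ext f 0 = 0"
  by (simp add: lin_ext_def)

lemma falg_expand: "p = (\<Sum>w\<in>Poly_Mapping.keys p. Poly_Mapping.lookup p w *\<^sub>Q mon w)"
proof (rule poly_mapping_eqI)
  fix k
  have "Poly_Mapping.lookup (\<Sum>w\<in>Poly_Mapping.keys p. Poly_Mapping.lookup p w *\<^sub>Q mon w) k = (\<Sum>w\<in>Poly_Mapping.keys p. if w = k then Poly_Mapping.lookup p w else 0)"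
    unfolding lookup_sum by (intro sum.cong) (auto simp: lookup_single when_def)
  then show "Poly_Mapping.lookup p k = Poly_Mapping.lookup (\<Sum>w\<in>Poly_Mapping.keys p. Poly_Mapping.lookup p w *\<^sub>Q mon w) k"
    by (simp add: in_keys_iff)
qed

lemma qspan_induct [case_names zero step]:
  assumes z: "P 0" and s: "\<And>c w p. P p \<Longrightarrow> P (c *\<^sub>Q mon w + p)"
  shows "P p"
proof -
  have "P (\<Sum>w\<in>A. Poly_Mapping.lookup p w *\<^sub>Q mon w)" if "finite A" for A
    using that by (induction) (auto intro: z s)
  from this[of "Poly_Mapping.keys p"] show ?thesis by (simp flip: falg_expand)
qed

lemma linear_eqI:
  assumes "qlinear f" "qlinear g" "\<And>w. f (mon w) = g (mon w)"
  shows "f = g"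
proof
  interpret f: Vector_Spaces.linear qscale qscale f by fact
  interpret g: Vector_Spaces.linear qscale qscale g by fact
  show "f p = g p" for p
    by (induction p rule: qspan_induct) (simp_all add: f.add g.add f.scale g.scale assms(3))
qed

lemma qscale_mult_left: "(c *\<^sub>Q p) * q = c *\<^sub>Q (p * q)"
  by (simp add: qscale_def mult_map_scale_conv_mult mult.assoc)

lemma mult_mon: "mon u * mon v = mon (u + v)"
  by (simp add: mult_single)

lemma single_0_commute: "p * Poly_Mapping.single 0 c = Poly_Mapping.single 0 c * (p :: ('k::monoid_add \<Rightarrow>\<^sub>0 rat))"
proof (induction p rule: qspan_induct)
  case (step d w p)
  have "(d *\<^sub>Q mon w) * Poly_Mapping.single 0 c = Poly_Mapping.single 0 c * (d *\<^sub>Q mon w)"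
    by (simp add: qscale_def mult_map_scale_conv_mult mult_single mult.commute)
  with step show ?case by (simp add: distrib_left distrib_right)
qed simp

lemma qscale_mult_right: "p * (c *\<^sub>Q q) = c *\<^sub>Q (p * (q :: ('k::monoid_add \<Rightarrow>\<^sub>0 rat)))"
  by (simp add: qscale_def mult_map_scale_conv_mult single_0_commute flip: mult.assoc)

lemma alg_ext_gen [simp]: "alg_ext f (mon [a]) = f a"
  by (simp add: alg_ext_def)

lemma alg_ext_one [simp]: "alg_ext f 1 = 1"
  using lin_ext_mon[of "\<lambda>w. prod_list (map f w)" 0] by (simp add: alg_ext_def) (simp add: zero_list_def)

lemma linear_alg_ext: "qlinear (alg_ext f)"
  by (simp add: alg_ext_def linear_lin_ext)

lemma alg_ext_mult: "alg_ext f (p * q) = alg_ext f p * alg_ext f q"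
proof (induction p rule: qspan_induct)
  case (step c u p)
  have "alg_ext f (mon u * q) = alg_ext f (mon u) * alg_ext f q"
  proof (induction q rule: qspan_induct)
    case (step d v q)
    then show ?case
      by (simp add: distrib_left qscale_mult_right mult_mon alg_ext_def lin_ext_add lin_ext_scale
          plus_list_def)
  qed (simp add: alg_ext_def)
  with step show ?case
    by (simp add: distrib_right qscale_mult_left alg_ext_def lin_ext_add lin_ext_scale)
qed (simp add: alg_ext_def)

lemma linear_der_ext: "qlinear (der_ext f)"
  by (simp add: der_ext_def linear_lin_ext)

lemma der_ext_gen [simp]: "der_ext f (mon [a]) = f a"
  using single_one[where 'a="'a list" and 'b=rat] by (simp add: der_ext_def zero_list_def)

lemma der_word_append: "der_word f (u @ v) = der_word f u * mon v + mon u * der_word f v"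
proof (induction u)
  case Nil
  show ?case using single_one[where 'a="'a list" and 'b=rat] by (simp add: zero_list_def)
next
  case (Cons a u)
  have "mon (u @ v) = mon u * mon v" "mon (a # u) = mon [a] * mon u"
    by (simp_all add: mult_mon plus_list_def)
  then show ?case by (simp add: Cons algebra_simps)
qed

lemma der_ext_mult: "der_ext f (p * q) = der_ext f p * q + p * der_ext f q"
proof (induction p rule: qspan_induct)
  case (step c u p)
  have "der_ext f (mon u * q) = der_ext f (mon u) * q + mon u * der_ext f q"
  proof (induction q rule: qspan_induct)
    case (step d v q)
    then show ?case
      by (simp add: distrib_left qscale_mult_right mult_mon der_ext_def lin_ext_add lin_ext_scale
          plus_list_def der_word_append QV.scale_right_distrib)
  qed (simp add: der_ext_def)
  with step show ?case
    by (simp add: distrib_right qscale_mult_left der_ext_def lin_ext_add lin_ext_scale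
          QV.scale_right_distrib)
qed (simp add: der_ext_def)

lemma lookup_tensor: "Poly_Mapping.lookup (p \<otimes>\<^sub>Q q) (u, v) = Poly_Mapping.lookup p u * Poly_Mapping.lookup q v"
proof -
  have "Poly_Mapping.lookup (p \<otimes>\<^sub>Q q) (u, v)
      = (\<Sum>u'\<in>Poly_Mapping.keys p. \<Sum>v'\<in>Poly_Mapping.keys q. if v' = v then (if u' = u then Poly_Mapping.lookup p u * Poly_Mapping.lookup q v else 0) else 0)"
    unfolding tensor_def lookup_sum
    by (intro sum.cong) (auto simp: lookup_single when_def)
  also have "\<dots> = (\<Sum>u'\<in>Poly_Mapping.keys p. if u' = u then Poly_Mapping.lookup p u * Poly_Mapping.lookup q v else 0)"
    by (intro sum.cong) (auto simp: in_keys_iff)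
  also have "\<dots> = Poly_Mapping.lookup p u * Poly_Mapping.lookup q v"
    by (simp add: in_keys_iff)
  finally show ?thesis .
qed

lemma tensor_mon: "mon u \<otimes>\<^sub>Q mon v = mon (u, v)"
  by (simp add: tensor_def)

lemma tensor_bilinear:
  "(p + p') \<otimes>\<^sub>Q q = p \<otimes>\<^sub>Q q + p' \<otimes>\<^sub>Q q" "p \<otimes>\<^sub>Q (q + q') = p \<otimes>\<^sub>Q q + p \<otimes>\<^sub>Q q'"
  "(c *\<^sub>Q p) \<otimes>\<^sub>Q q = c *\<^sub>Q (p \<otimes>\<^sub>Q q)" "p \<otimes>\<^sub>Q (c *\<^sub>Q q) = c *\<^sub>Q (p \<otimes>\<^sub>Q q)"
  "0 \<otimes>\<^sub>Q q = 0" "p \<otimes>\<^sub>Q 0 = 0"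
  by (auto intro!: poly_mapping_eqI simp: lookup_tensor lookup_add algebra_simps)

lemma tensor_map_tensor:
  assumes "qlinear f" "qlinear g"
  shows "tensor_map f g (p \<otimes>\<^sub>Q q) = f p \<otimes>\<^sub>Q g q"
proof -
  interpret f: Vector_Spaces.linear qscale qscale f by fact
  interpret g: Vector_Spaces.linear qscale qscale g by fact
  show ?thesis
  proof (induction p rule: qspan_induct)
    case (step c u p)
    have "tensor_map f g (mon u \<otimes>\<^sub>Q q) = f (mon u) \<otimes>\<^sub>Q g q"
    proof (induction q rule: qspan_induct)
      case (step d v q)
      then show ?case
        by (simp add: tensor_map_def tensor_bilinear tensor_mon lin_ext_add lin_ext_scale g.add g.scale)
    qed (simp add: tensor_map_def tensor_bilinear g.zero)
    with step show ?case
      by (simp add: tensor_map_def tensor_bilinear lin_ext_add lin_ext_scale f.add f.scale)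
  qed (simp add: tensor_map_def tensor_bilinear f.zero)
qed

section \<open>The alphabets $X$ and $Y$\<close>

datatype xletter = X0 | X1

text \<open>The alphabet $Y$ is indexed from $1$: the constructor term \<open>Y m\<close> is the letter $y_{m+1}$.\<close>

datatype yletter = Y nat

abbreviation x0 :: "xletter falg" where "x0 \<equiv> mon [X0]"
abbreviation x1 :: "xletter falg" where "x1 \<equiv> mon [X1]"

abbreviation Delta_X :: "xletter falg \<Rightarrow> xletter falg2" where "Delta_X \<equiv> coprod"
abbreviation Delta_Y :: "yletter falg \<Rightarrow> yletter falg2" where "Delta_Y \<equiv> coprod"

abbreviation LieX :: "xletter falg set" where "LieX \<equiv> primitives"

definition xword :: "yletter list \<Rightarrow> xletter list" where
  "xword ks = concat (map (\<lambda>k. case k of Y m \<Rightarrow> replicate m X0 @ [X1]) ks)"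

text \<open>
  \<open>yword r w\<close> reads \<open>w\<close> from left to right, \<open>r\<close> being the number of letters $x_0$ read since
  the last $x_1$; the result is \<open>None\<close> if the word ends in $x_0$.
\<close>

fun yword :: "nat \<Rightarrow> xletter list \<Rightarrow> yletter list option" where
  "yword r [] = (if r = 0 then Some [] else None)"
| "yword r (X0 # w) = yword (Suc r) w"
| "yword r (X1 # w) = map_option ((#) (Y r)) (yword 0 w)"

definition pi_Y :: "xletter falg \<Rightarrow> yletter falg" where
  "pi_Y = lin_ext (\<lambda>w. case yword 0 w of None \<Rightarrow> 0 | Some ks \<Rightarrow> mon ks)"

lemma yword_replicate: "yword r (replicate m X0 @ w) = yword (r + m) w"
  by (induction m arbitrary: r) auto

lemma yword_xword: "yword 0 (xword ks @ replicate r X0) = (if r = 0 then Some ks else None)"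
proof (induction ks)
  case Nil
  show ?case using yword_replicate[of 0 r "[]"] by (simp add: xword_def)
next
  case (Cons k ks)
  then show ?case by (cases k) (auto simp: xword_def yword_replicate)
qed

lemma pi_Y_word: "pi_Y (mon (xword ks @ replicate r X0)) = (if r = 0 then mon ks else 0)"
  by (simp add: pi_Y_def yword_xword)

lemma xword_cases: "\<exists>ks r. w = xword ks @ replicate r X0"
proof (induction w)
  case Nil
  show ?case by (rule exI[of _ "[]"], rule exI[of _ 0]) (simp add: xword_def)
next
  case (Cons a w)
  then obtain ks r where w: "w = xword ks @ replicate r X0" by blast
  show ?case
  proof (cases a)
    case X1
    then have "a # w = xword (Y 0 # ks) @ replicate r X0" by (simp add: w xword_def)
    then show ?thesis by blast
  next
    case X0
    show ?thesis
    proof (cases ks)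
      case Nil
      with X0 w have "a # w = xword [] @ replicate (Suc r) X0" by (simp add: xword_def)
      then show ?thesis by blast
    next
      case (Cons k ks')
      obtain m where "k = Y m" by (cases k)
      with Cons X0 w have "a # w = xword (Y (Suc m) # ks') @ replicate r X0" by (simp add: xword_def)
      then show ?thesis by blast
    qed
  qed
qed

section \<open>The stabilizer Lie algebra and the linearized double shuffle space\<close>

definition d_der :: "xletter falg \<Rightarrow> xletter falg \<Rightarrow> xletter falg" where
  "d_der \<psi> = der_ext (\<lambda>a. case a of X0 \<Rightarrow> 0 | X1 \<Rightarrow> x1 * \<psi> - \<psi> * x1)"

definition s_op :: "xletter falg \<Rightarrow> xletter falg \<Rightarrow> xletter falg" where
  "s_op \<psi> p = \<psi> * p + d_der \<psi> p"

definition sY_op :: "xletter falg \<Rightarrow> yletter falg \<Rightarrow> yletter falg" where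
  "sY_op \<psi> = (THE f. qlinear f \<and> pi_Y \<circ> s_op \<psi> = f \<circ> pi_Y)"

definition stab_Delta_Y :: "xletter falg set" where
  "stab_Delta_Y = {\<psi> \<in> LieX.
     (\<lambda>t. tensor_map (sY_op \<psi>) id t + tensor_map id (sY_op \<psi>) t) \<circ> Delta_Y
       = Delta_Y \<circ> sY_op \<psi>}"

definition ls :: "xletter falg set" where
  "ls = {\<psi>.
     Poly_Mapping.lookup \<psi> [X0] = 0 \<and> Poly_Mapping.lookup \<psi> [X1] = 0 \<and>
     Delta_X \<psi> = \<psi> \<otimes>\<^sub>Q 1 + 1 \<otimes>\<^sub>Q \<psi> \<and>
     Delta_Y (pi_Y \<psi>) = pi_Y \<psi> \<otimes>\<^sub>Q 1 + 1 \<otimes>\<^sub>Q pi_Y \<psi> \<and>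
     (\<forall>n\<ge>2. even n \<longrightarrow> Poly_Mapping.lookup \<psi> (replicate (n - 1) X0 @ [X1]) = 0)}"

definition bihomogeneous :: "nat \<Rightarrow> nat \<Rightarrow> xletter falg set" where
  "bihomogeneous n d = {\<psi>. \<forall>w\<in>Poly_Mapping.keys \<psi>. length w = n \<and> count_list w X1 = d}"

text \<open>The sum of the subspaces \<open>V \<inter> bihomogeneous n d\<close> below is direct because
  it is so in the ambient algebra.\<close>

definition bigraded_subspace_LieX :: "xletter falg set \<Rightarrow> bool" where
  "bigraded_subspace_LieX V \<longleftrightarrow>
     V \<subseteq> LieX \<and> QV.subspace V \<and> V = QV.span (\<Union>n d. V \<inter> bihomogeneous n d)"

subsection \<open>Existence and uniqueness of the operator on the $Y$ side\<close>

lemma linear_s_op: "qlinear (s_op \<psi>)"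
proof -
  interpret d: Vector_Spaces.linear qscale qscale "d_der \<psi>"
    by (simp add: d_der_def linear_der_ext)
  show ?thesis
    by (rule Vector_Spaces.linear.intro; unfold_locales)
      (simp_all add: s_op_def d.add d.scale distrib_left qscale_mult_right QV.scale_right_distrib)
qed

lemma pi_Y_mult_x0: "pi_Y (p * x0) = 0"
proof (induction p rule: qspan_induct)
  case (step c w p)
  obtain ks r where w: "w = xword ks @ replicate r X0" using xword_cases by blast
  have "mon w * x0 = mon (xword ks @ replicate (Suc r) X0)"
    by (simp add: w mult_mon plus_list_def replicate_append_same)
  then have "pi_Y (mon w * x0) = 0"
    by (simp only: pi_Y_word) simp
  with step show ?case
    by (simp add: distrib_right qscale_mult_left pi_Y_def lin_ext_add lin_ext_scale)
qed (simp add: pi_Y_def)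

lemma s_op_mult_x0: "s_op \<psi> (p * x0) = s_op \<psi> p * x0"
  by (simp add: s_op_def d_der_def der_ext_mult algebra_simps)

lemma sY_op_ex1: "\<exists>!f. qlinear f \<and> pi_Y \<circ> s_op \<psi> = f \<circ> pi_Y"
proof
  interpret p: Vector_Spaces.linear qscale qscale pi_Y by (simp add: pi_Y_def linear_lin_ext)
  interpret s: Vector_Spaces.linear qscale qscale "s_op \<psi>" by (rule linear_s_op)
  let ?f = "lin_ext (\<lambda>ks. pi_Y (s_op \<psi> (mon (xword ks))))"
  interpret f: Vector_Spaces.linear qscale qscale ?f by (rule linear_lin_ext)
  show "qlinear ?f \<and> pi_Y \<circ> s_op \<psi> = ?f \<circ> pi_Y"
  proof (intro conjI linear_eqI)
    show "qlinear ?f" by (rule linear_lin_ext)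
    show "qlinear (pi_Y \<circ> s_op \<psi>)"
      by (rule Vector_Spaces.linear_compose[OF s.linear_axioms p.linear_axioms])
    show "qlinear (?f \<circ> pi_Y)"
      by (rule Vector_Spaces.linear_compose[OF p.linear_axioms f.linear_axioms])
    fix w
    obtain ks r where w: "w = xword ks @ replicate r X0" using xword_cases by blast
    show "(pi_Y \<circ> s_op \<psi>) (mon w) = (?f \<circ> pi_Y) (mon w)"
    proof (cases r)
      case 0
      with w show ?thesis using pi_Y_word[of ks 0] by simp
    next
      case (Suc r')
      have "mon w = mon (xword ks @ replicate r' X0) * x0"
        by (simp add: w Suc mult_mon plus_list_def replicate_append_same)
      then have "pi_Y (s_op \<psi> (mon w)) = 0"
        by (simp only: s_op_mult_x0 pi_Y_mult_x0)
      moreover have "pi_Y (mon w) = 0" by (simp only: w pi_Y_word) (simp add: Suc)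
      ultimately show ?thesis by simp
    qed
  qed
  fix g assume g: "qlinear g \<and> pi_Y \<circ> s_op \<psi> = g \<circ> pi_Y"
  show "g = ?f"
  proof (rule linear_eqI)
    show "qlinear g" using g by simp
    show "qlinear ?f" by (rule linear_lin_ext)
    fix ks
    have "mon ks = pi_Y (mon (xword ks))" using pi_Y_word[of ks 0] by simp
    then have "g (mon ks) = (g \<circ> pi_Y) (mon (xword ks))" by simp
    also have "\<dots> = pi_Y (s_op \<psi> (mon (xword ks)))" using g by (metis comp_apply)
    finally show "g (mon ks) = ?f (mon ks)" by simp
  qed
qed

lemma sY_op_spec: "qlinear (sY_op \<psi>)" "pi_Y \<circ> s_op \<psi> = sY_op \<psi> \<circ> pi_Y"
  using theI'[OF sY_op_ex1[of \<psi>]] unfolding sY_op_def by auto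

end

theory Submission
  imports Defs "HOL-Library.Multiset"
begin

text \<open>
  The operator $s^Y_\psi$ is right multiplication by $\pi_Y(\psi)$ plus the derivation sending
  $y_{m+1}$ to $[\psi, x_0^m] x_1$. Evaluating at $1$ and at letters, $\psi$ stabilizes $\Delta_Y$
  iff $\pi_Y(\psi)$ and all $[\psi, x_0^m] x_1$ are $\Delta_Y$-primitive.

  Write $c(a_0, \dots, a_d)$ for the coefficient of $x_0^{a_0} x_1 \cdots x_1 x_0^{a_d}$ in an element
  of $\mathfrak{ls}$. Shuffling with $x_0$ propagates the shuffle relations on the $Y$ side from
  $a_d = 0$ to every fixed $a_d$. Comparing the antipodes for $\Delta_X$ and for $\Delta_Y$ then shows
  that $c$ is invariant under cyclic rotation up to the sign $(-1)^{a_0 + \dots + a_d}$; when this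
  sign is $-1$, the shuffle relations (or, for $d = 1$, the parity condition) force $c = 0$, so $c$ is
  cyclically invariant. In the shuffle relations for $[\psi, x_0^m] x_1$, the terms with
  prescribed last letter and those with prescribed first letter therefore cancel.

  Conversely, the coefficient of $y_{n+1} \otimes y_1$ in the relation for $[\psi, x_0] x_1$, together
  with the antipode for $\Delta_X$, gives the parity condition in depth one.
\<close>

abbreviation coef :: "('k \<Rightarrow>\<^sub>0 rat) \<Rightarrow> 'k \<Rightarrow> rat" where
  "coef \<equiv> Poly_Mapping.lookup"

section \<open>Sums over shuffles\<close>

text \<open>The pairing of \<open>f\<close> with the shuffle product of \<open>u\<close> and
  \<open>v\<close>, with multiplicities. Letters already taken are absorbed into \<open>f\<close>,
  so no list of shuffles is formed.\<close>

fun shsum :: "('a list \<Rightarrow> rat) \<Rightarrow> 'a list \<Rightarrow> 'a list \<Rightarrow> rat" where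
  "shsum f [] v = f v"
| "shsum f (a # u) [] = f (a # u)"
| "shsum f (a # u) (b # v) = shsum (\<lambda>w. f (a # w)) u (b # v) + shsum (\<lambda>w. f (b # w)) (a # u) v"

lemma shsum_Nil2 [simp]: "shsum f u [] = f u"
  by (cases u) auto

lemma shsum_add: "shsum (\<lambda>w. f w + g w) u v = shsum f u v + shsum g u v"
  by (induction f u v arbitrary: g rule: shsum.induct) auto

lemma shsum_scale: "shsum (\<lambda>w. c * f w) u v = c * shsum f u v"
  by (induction f u v rule: shsum.induct) (auto simp: algebra_simps)

lemma shsum_zero [simp]: "shsum (\<lambda>w. 0) u v = 0"
  using shsum_scale[of 0 "\<lambda>w. 0"] by simp

lemma shsum_minus: "shsum (\<lambda>w. - f w) u v = - shsum f u v"
  using shsum_scale[of "-1" f] by simp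

lemma shsum_diff: "shsum (\<lambda>w. f w - g w) u v = shsum f u v - shsum g u v"
  using shsum_add[of f "\<lambda>w. - g w"] by (simp add: shsum_minus)

text \<open>All shuffles of \<open>u\<close> and \<open>v\<close> have the same content, so
  quantities such as the length or the sum of the entries act as constants.\<close>

lemma shsum_cong:
  assumes "\<And>w. mset w = mset u + mset v \<Longrightarrow> f w = g w"
  shows "shsum f u v = shsum g u v"
  using assms
proof (induction f u v arbitrary: g rule: shsum.induct)
  case (3 f a u b v)
  have "shsum (\<lambda>w. f (a # w)) u (b # v) = shsum (\<lambda>w. g (a # w)) u (b # v)"
    by (rule "3.IH"(1), rule "3.prems") simp
  moreover have "shsum (\<lambda>w. f (b # w)) (a # u) v = shsum (\<lambda>w. g (b # w)) (a # u) v"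
    by (rule "3.IH"(2), rule "3.prems") simp
  ultimately show ?case by simp
qed auto

text \<open>Sorts the shuffles by last letter, where the defining recursion sorts them by first
  letter.\<close>

lemma shsum_snoc:
  "shsum f (u @ [a]) (v @ [b])
    = shsum (\<lambda>w. f (w @ [a])) u (v @ [b]) + shsum (\<lambda>w. f (w @ [b])) (u @ [a]) v"
proof (induction f u v rule: shsum.induct)
  case (1 f v)
  show ?case
  proof (induction v arbitrary: f)
    case (Cons c v)
    then show ?case by simp
  qed simp
next
  case (2 f c u)
  show ?case
  proof (induction u arbitrary: f c)
    case (Cons d u)
    then show ?case by simp
  qed simp
next
  case (3 f c u d v)
  then show ?case by simp
qed

lemma shsum_map: "shsum f (map h u) (map h v) = shsum (\<lambda>w. f (map h w)) u v"
proof (induction "length u + length v" arbitrary: f u v rule: less_induct)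
  case less
  show ?case
  proof (cases u)
    case (Cons a u')
    show ?thesis
    proof (cases v)
      case (Cons b v')
      then show ?thesis
        using less[of u' v "\<lambda>w. f (h a # w)"] less[of u v' "\<lambda>w. f (h b # w)"]
        by (simp add: \<open>u = a # u'\<close>)
    qed simp
  qed simp
qed

section \<open>Alternal functions: vanishing on nontrivial shuffles\<close>

definition alternal :: "('a list \<Rightarrow> rat) \<Rightarrow> bool" where
  "alternal f \<longleftrightarrow> f [] = 0 \<and> (\<forall>u v. u \<noteq> [] \<longrightarrow> v \<noteq> [] \<longrightarrow> shsum f u v = 0)"

lemma alternal_Nil: "alternal f \<Longrightarrow> f [] = 0"
  by (simp add: alternal_def)

lemma alternal_shsum: "alternal f \<Longrightarrow> u \<noteq> [] \<Longrightarrow> v \<noteq> [] \<Longrightarrow> shsum f u v = 0"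
  by (simp add: alternal_def)

text \<open>The vanishing sum over shuffles of \<open>b # rev x\<close> and \<open>a # y\<close>
  splits by first letter; each letter of \<open>x\<close> moved across thus costs one sign.\<close>

lemma alternal_shsum_rev:
  assumes "alternal f"
  shows "shsum (\<lambda>w. f (a # w)) (rev x) y = (-1) ^ length x * f (x @ a # y)"
proof (induction x arbitrary: a y rule: rev_induct)
  case (snoc b x)
  have "shsum f (b # rev x) (a # y) = 0"
    by (rule alternal_shsum[OF assms]) simp_all
  with snoc[of b "a # y"] show ?case by simp
qed simp

text \<open>The antipode, reversal with sign (-1)^length, acts as -1 on primitive elements.\<close>

lemma alternal_rev:
  assumes "alternal f"
  shows "f (rev w) = - ((-1) ^ length w) * f w"
proof (cases w rule: rev_cases)
  case (snoc x a)
  with alternal_shsum_rev[OF assms, of a x "[]"] show ?thesis by simp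
qed (simp add: alternal_Nil[OF assms])

lemma alternal_scale: "alternal f \<Longrightarrow> alternal (\<lambda>w. c * f w)"
  by (simp add: alternal_def shsum_scale)

text \<open>A shuffle relation involves words of one content only, so restricting to a union of
  content classes preserves it. This yields the bigrading of \<open>ls\<close>.\<close>

lemma alternal_restrict:
  assumes "alternal f" and "\<And>w w'. mset w = mset w' \<Longrightarrow> P w = P w'"
  shows "alternal (\<lambda>w. if P w then f w else 0)"
  unfolding alternal_def
proof (intro conjI allI impI)
  show "(if P [] then f [] else 0) = 0" using alternal_Nil[OF assms(1)] by simp
  fix u v :: "'a list" assume "u \<noteq> []" "v \<noteq> []"
  then have 0: "shsum f u v = 0" by (rule alternal_shsum[OF assms(1)])
  have "shsum (\<lambda>w. if P w then f w else 0) u v = shsum (\<lambda>w. (if P (u @ v) then 1 else 0) * f w) u v"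
  proof (rule shsum_cong)
    fix w assume "mset w = mset u + mset v"
    then have "P w = P (u @ v)" by (intro assms(2)) simp
    then show "(if P w then f w else 0) = (if P (u @ v) then 1 else 0) * f w" by simp
  qed
  with 0 show "shsum (\<lambda>w. if P w then f w else 0) u v = 0" by (simp only: shsum_scale)
qed

text \<open>Once a letter is split off, alternality kills the remaining sum unless the word that
  lost its letter was a singleton. Both ends leave the same exceptional terms
  \<open>?c\<close>.\<close>

lemma shsum_last_eq_hd:
  assumes "\<And>a. alternal (g a)" and "u \<noteq> []" "v \<noteq> []"
  shows "shsum (\<lambda>w. g (last w) (butlast w)) u v = shsum (\<lambda>w. g (hd w) (tl w)) u v"
proof -
  let ?c = "(if tl u = [] then g (hd u) v else 0) + (if tl v = [] then g (hd v) u else 0)"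
  obtain a u' where u: "u = a # u'" using assms(2) by (cases u) auto
  obtain b v' where v: "v = b # v'" using assms(3) by (cases v) auto
  obtain c u'' where u2: "u = u'' @ [c]" using assms(2) by (cases u rule: rev_cases) auto
  obtain d v'' where v2: "v = v'' @ [d]" using assms(3) by (cases v rule: rev_cases) auto
  have "shsum (\<lambda>w. g (hd w) (tl w)) u v = shsum (g a) u' v + shsum (g b) u v'"
    by (simp add: u v)
  also have "\<dots> = ?c"
    using alternal_shsum[OF assms(1), of u' v] alternal_shsum[OF assms(1), of u v']
    by (auto simp: u v)
  finally have 1: "shsum (\<lambda>w. g (hd w) (tl w)) u v = ?c" .
  have "shsum (\<lambda>w. g (last w) (butlast w)) u v = shsum (g c) u'' v + shsum (g d) u v''"
    by (simp add: u2 v2 shsum_snoc)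
  also have "\<dots> = (if u'' = [] then g c v else 0) + (if v'' = [] then g d u else 0)"
    using alternal_shsum[OF assms(1), of u'' v] alternal_shsum[OF assms(1), of u v'']
    by (auto simp: u2 v2)
  also have "\<dots> = ?c"
    by (cases u''; cases v'') (auto simp: u2 v2)
  finally show ?thesis using 1 by simp
qed

section \<open>Coefficients of products and coproducts\<close>

lemma coef_mon: "coef (mon w) x = (if x = w then 1 else 0)"
  by (auto simp: lookup_single when_def)

text \<open>Serves both words and pairs of words; cancellation enters as injectivity.\<close>

lemma coef_mon_mult:
  fixes t :: "'k::monoid_add \<Rightarrow>\<^sub>0 rat"
  assumes "inj ((+) k)"
  shows "coef (mon k * t) (k + x) = coef t x"
proof (induction t rule: qspan_induct)
  case (step c w p)
  have "k + x = k + w \<longleftrightarrow> x = w" using assms by (auto dest: injD)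
  with step show ?case
    by (simp add: distrib_left qscale_mult_right mult_mon lookup_add coef_mon)
qed simp

lemma coef_mon_mult_eq_0:
  fixes t :: "'k::monoid_add \<Rightarrow>\<^sub>0 rat"
  assumes "\<And>x. y \<noteq> k + x"
  shows "coef (mon k * t) y = 0"
  by (induction t rule: qspan_induct)
    (simp_all add: distrib_left qscale_mult_right mult_mon lookup_add coef_mon assms)

lemma coef_mult_mon:
  fixes t :: "'k::monoid_add \<Rightarrow>\<^sub>0 rat"
  assumes "inj (\<lambda>x. x + k)"
  shows "coef (t * mon k) (x + k) = coef t x"
proof (induction t rule: qspan_induct)
  case (step c w p)
  have "x + k = w + k \<longleftrightarrow> x = w" using assms by (auto dest: injD)
  with step show ?case
    by (simp add: distrib_right qscale_mult_left mult_mon lookup_add coef_mon)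
qed simp

lemma coef_mult_mon_eq_0:
  fixes t :: "'k::monoid_add \<Rightarrow>\<^sub>0 rat"
  assumes "\<And>x. y \<noteq> x + k"
  shows "coef (t * mon k) y = 0"
  by (induction t rule: qspan_induct)
    (simp_all add: distrib_right qscale_mult_left mult_mon lookup_add coef_mon assms)

lemma coef_mon_mult_list: "coef (mon u * p) (u @ w) = coef p w"
  using coef_mon_mult[of u p w] by (simp add: plus_list_def inj_def)

lemma coef_mult_mon_list: "coef (p * mon u) (w @ u) = coef p w"
  using coef_mult_mon[of u p w] by (simp add: plus_list_def inj_def)

lemma mon_Nil: "mon [] = (1 :: 'a falg)"
  by (metis single_one zero_list_def)

lemma mon_Nil_Nil: "mon ([], []) = (1 :: 'a falg2)"
  by (metis single_one zero_list_def zero_prod_def)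

lemma mon_append: "mon (u @ v) = mon u * mon v"
  by (simp add: mult_mon plus_list_def)

lemma coef_one_list: "coef (1 :: 'a falg) w = (if w = [] then 1 else 0)"
  by (simp add: coef_mon flip: mon_Nil)

lemma tensor_mon_one: "mon u \<otimes>\<^sub>Q 1 = mon (u, [])" "1 \<otimes>\<^sub>Q mon u = mon ([], u)"
  by (simp_all add: tensor_mon flip: mon_Nil)

lemma coef_left_letter:
  fixes t :: "'a falg2"
  shows "coef (mon ([a], []) * t) (u, v) = (case u of [] \<Rightarrow> 0 | b # u' \<Rightarrow> if b = a then coef t (u', v) else 0)"
proof -
  have "inj ((+) ([a], [] :: 'a list))" by (auto simp: inj_def plus_list_def)
  from coef_mon_mult[OF this, of t "(u', v)" for u'] have "coef (mon ([a], []) * t) (a # u', v) = coef t (u', v)" for u'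
    by (simp add: plus_list_def)
  moreover have "coef (mon ([a], []) * t) (u, v) = 0" if "\<And>u'. u \<noteq> a # u'"
    by (rule coef_mon_mult_eq_0) (use that in \<open>auto simp: plus_list_def\<close>)
  ultimately show ?thesis by (auto split: list.split)
qed

lemma coef_right_letter:
  fixes t :: "'a falg2"
  shows "coef (mon ([], [a]) * t) (u, v) = (case v of [] \<Rightarrow> 0 | b # v' \<Rightarrow> if b = a then coef t (u, v') else 0)"
proof -
  have "inj ((+) ([] :: 'a list, [a]))" by (auto simp: inj_def plus_list_def)
  from coef_mon_mult[OF this, of t "(u, v')" for v'] have "coef (mon ([], [a]) * t) (u, a # v') = coef t (u, v')" for v'
    by (simp add: plus_list_def)
  moreover have "coef (mon ([], [a]) * t) (u, v) = 0" if "\<And>v'. v \<noteq> a # v'"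
    by (rule coef_mon_mult_eq_0) (use that in \<open>auto simp: plus_list_def\<close>)
  ultimately show ?thesis by (auto split: list.split)
qed

lemma coprod_add: "coprod (p + q) = coprod p + coprod q"
  by (simp add: coprod_def alg_ext_def lin_ext_add)

lemma coprod_scale: "coprod (c *\<^sub>Q p) = c *\<^sub>Q coprod p"
  by (simp add: coprod_def alg_ext_def lin_ext_scale)

lemma coprod_mult: "coprod (p * q) = coprod p * coprod q"
  by (simp add: coprod_def alg_ext_mult)

lemma coprod_one: "coprod 1 = 1"
  by (simp add: coprod_def)

lemma coprod_letter: "coprod (mon [a]) = mon ([a], []) + mon ([], [a])"
  by (simp add: coprod_def tensor_mon_one)

lemma coprod_Cons: "coprod (mon (a # w)) = mon ([a], []) * coprod (mon w) + mon ([], [a]) * coprod (mon w)"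
  using coprod_mult[of "mon [a]" "mon w"] mon_append[of "[a]" w]
  by (simp add: coprod_letter distrib_right)

text \<open>Duality of coproduct and shuffle: the first letter goes to the left or to the right
  tensor factor, which is the recursion of \<open>shsum\<close>.\<close>

lemma coef_coprod: "coef (coprod p) (u, v) = shsum (coef p) u v"
proof (induction p rule: qspan_induct)
  case zero
  show ?case by (simp add: coprod_def alg_ext_def)
next
  case (step c w p)
  have "coef (coprod (mon w)) (u, v) = shsum (coef (mon w)) u v"
  proof (induction w arbitrary: u v)
    case Nil
    show ?case
      by (cases u; cases v)
        (simp_all add: coprod_one mon_Nil coef_one_list, simp_all add: coef_mon flip: mon_Nil_Nil)
  next
    case (Cons a w)
    have *: "shsum (\<lambda>x. coef (mon (a # w)) (b # x)) u v
        = (if b = a then shsum (coef (mon w)) u v else 0)" for b u v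
    proof -
      have "(\<lambda>x. coef (mon (a # w)) (b # x)) = (if b = a then coef (mon w) else (\<lambda>x. 0))"
        by (auto simp: coef_mon)
      then show ?thesis by simp
    qed
    show ?case
      by (cases u; cases v)
        (simp_all add: coprod_Cons lookup_add coef_left_letter coef_right_letter Cons *
          , simp_all add: coef_mon)
  qed
  with step show ?case
    by (simp add: coprod_add coprod_scale lookup_add shsum_add shsum_scale)
qed

text \<open>Ree's criterion. At two empty words primitivity reads c = 2c for the constant term c,
  which therefore vanishes.\<close>

lemma primitives_iff_alternal: "p \<in> primitives \<longleftrightarrow> alternal (coef p)"
proof
  assume p: "p \<in> primitives"
  then have *: "shsum (coef p) u v = coef p u * coef 1 v + coef 1 u * coef p v" for u v
    by (simp add: primitives_def lookup_add lookup_tensor flip: coef_coprod)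
  from *[of "[]" "[]"] have "coef p [] = 0" by (simp add: coef_one_list)
  with * show "alternal (coef p)" by (auto simp: alternal_def coef_one_list)
next
  assume a: "alternal (coef p)"
  have "coef (coprod p) (u, v) = coef (p \<otimes>\<^sub>Q 1 + 1 \<otimes>\<^sub>Q p) (u, v)" for u v
    using alternal_Nil[OF a] alternal_shsum[OF a, of u v]
    by (cases "u = []"; cases "v = []")
      (auto simp: coef_coprod lookup_add lookup_tensor coef_one_list)
  then show "p \<in> primitives"
    by (auto simp: primitives_def intro!: poly_mapping_eqI)
qed

lemma subspace_primitives: "QV.subspace primitives"
  by (rule QV.subspaceI)
    (simp_all add: primitives_def coprod_add coprod_scale tensor_bilinear QV.scale_right_distrib
      add_ac, simp add: coprod_def alg_ext_def)

lemma letter_in_primitives: "mon [a] \<in> primitives"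
  by (simp add: primitives_def coprod_letter tensor_mon_one)


section \<open>Coderivations of the tensor square\<close>

lemma tensor_mult: "(p \<otimes>\<^sub>Q q) * (p' \<otimes>\<^sub>Q q') = (p * p') \<otimes>\<^sub>Q (q * q')"
proof (induction p rule: qspan_induct)
  case (step c u p)
  have "(mon u \<otimes>\<^sub>Q q) * (p' \<otimes>\<^sub>Q q') = (mon u * p') \<otimes>\<^sub>Q (q * q')"
  proof (induction q rule: qspan_induct)
    case (step c v q)
    have "(mon u \<otimes>\<^sub>Q mon v) * (p' \<otimes>\<^sub>Q q') = (mon u * p') \<otimes>\<^sub>Q (mon v * q')"
    proof (induction p' rule: qspan_induct)
      case (step c u' p')
      have "(mon u \<otimes>\<^sub>Q mon v) * (mon u' \<otimes>\<^sub>Q q') = (mon u * mon u') \<otimes>\<^sub>Q (mon v * q')"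
        by (induction q' rule: qspan_induct)
          (simp_all add: tensor_bilinear distrib_left qscale_mult_right tensor_mon mult_mon)
      with step show ?case
        by (simp add: tensor_bilinear distrib_left qscale_mult_right)
    qed (simp add: tensor_bilinear)
    with step show ?case
      by (simp add: tensor_bilinear distrib_left distrib_right qscale_mult_right qscale_mult_left)
  qed (simp add: tensor_bilinear)
  with step show ?case
    by (simp add: tensor_bilinear distrib_left distrib_right qscale_mult_right qscale_mult_left)
qed (simp add: tensor_bilinear)

text \<open>The operator in the stabilizer condition, which thus says that
  \<open>sY_op \<psi>\<close> is a coderivation.\<close>

definition tensor_der :: "('a falg \<Rightarrow> 'a falg) \<Rightarrow> 'a falg2 \<Rightarrow> 'a falg2" where
  "tensor_der f t = tensor_map f id t + tensor_map id f t"

lemma tensor_der_add: "tensor_der f (s + t) = tensor_der f s + tensor_der f t"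
  by (simp add: tensor_der_def tensor_map_def lin_ext_add)

lemma tensor_der_scale: "tensor_der f (c *\<^sub>Q t) = c *\<^sub>Q tensor_der f t"
  by (simp add: tensor_der_def tensor_map_def lin_ext_scale QV.scale_right_distrib)

lemma tensor_der_zero [simp]: "tensor_der f 0 = 0"
  by (simp add: tensor_der_def tensor_map_def)

lemma tensor_der_mon: "tensor_der f (mon (u, v)) = f (mon u) \<otimes>\<^sub>Q mon v + mon u \<otimes>\<^sub>Q f (mon v)"
  by (simp add: tensor_der_def tensor_map_def)

lemma tensor_der_plus: "tensor_der (\<lambda>q. f q + g q) t = tensor_der f t + tensor_der g t"
proof (induction t rule: qspan_induct)
  case (step c w p)
  obtain u v where "w = (u, v)" by (cases w)
  with step show ?case
    by (simp add: tensor_der_add tensor_der_scale tensor_der_mon tensor_bilinear QV.scale_right_distrib)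
qed simp

lemma tensor_der_right_mult:
  "tensor_der (\<lambda>q. q * p) t = t * (p \<otimes>\<^sub>Q 1 + 1 \<otimes>\<^sub>Q p)"
proof (induction t rule: qspan_induct)
  case (step c w t)
  obtain u v where w: "w = (u, v)" by (cases w)
  have "mon w * (p \<otimes>\<^sub>Q 1 + 1 \<otimes>\<^sub>Q p) = tensor_der (\<lambda>q. q * p) (mon w)"
    unfolding w tensor_der_mon by (simp add: distrib_left tensor_mult flip: tensor_mon)
  with step show ?case
    by (simp add: tensor_der_add tensor_der_scale distrib_right qscale_mult_left)
qed simp

lemma der_ext_zero [simp]: "der_ext f 0 = 0"
  by (simp add: der_ext_def)

lemma der_ext_one [simp]: "der_ext f 1 = 0"
  by (simp add: der_ext_def flip: mon_Nil)

lemma tensor_der_der_ext_mult: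
  "tensor_der (der_ext f) (s * t) = tensor_der (der_ext f) s * t + s * tensor_der (der_ext f) t"
proof (induction s rule: qspan_induct)
  case (step c w s)
  obtain u v where w: "w = (u, v)" by (cases w)
  have "tensor_der (der_ext f) (mon w * t) = tensor_der (der_ext f) (mon w) * t + mon w * tensor_der (der_ext f) t"
  proof (induction t rule: qspan_induct)
    case (step c w' t)
    obtain u' v' where w': "w' = (u', v')" by (cases w')
    have eq: "mon w * mon w' = mon (u @ u', v @ v')"
      by (simp add: mult_mon w w' plus_list_def)
    have "tensor_der (der_ext f) (mon w * mon w')
        = tensor_der (der_ext f) (mon w) * mon w' + mon w * tensor_der (der_ext f) (mon w')"
      unfolding eq unfolding w w' tensor_der_mon
      by (simp add: mon_append der_ext_mult tensor_bilinear distrib_left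
          distrib_right tensor_mult flip: tensor_mon)
    with step show ?case
      by (simp add: tensor_der_add tensor_der_scale distrib_left qscale_mult_right
          QV.scale_right_distrib)
  qed simp
  with step show ?case
    by (simp add: tensor_der_add tensor_der_scale distrib_right qscale_mult_left
          QV.scale_right_distrib)
qed simp

lemma coderivation_right_mult:
  assumes "p \<in> primitives"
  shows "tensor_der (\<lambda>q. q * p) (coprod q) = coprod (q * p)"
  using assms by (simp add: tensor_der_right_mult coprod_mult primitives_def)

lemma tensor_der_der_ext_letter:
  "tensor_der (der_ext f) (coprod (mon [a])) = f a \<otimes>\<^sub>Q 1 + 1 \<otimes>\<^sub>Q f a"
  by (simp add: coprod_letter tensor_der_add tensor_der_mon mon_Nil tensor_bilinear)

text \<open>Both sides are derivations along the algebra morphism \<open>coprod\<close>, so it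
  suffices to compare them on letters, where equality is primitivity of \<open>f a\<close>.\<close>

lemma coderivation_der_ext:
  assumes "\<And>a. f a \<in> primitives"
  shows "tensor_der (der_ext f) (coprod q) = coprod (der_ext f q)"
proof (induction q rule: qspan_induct)
  case zero
  show ?case by (simp add: coprod_def alg_ext_def)
next
  case (step c w q)
  have "tensor_der (der_ext f) (coprod (mon w)) = coprod (der_ext f (mon w))"
  proof (induction w)
    case Nil
    have "tensor_der (der_ext f) (1 :: 'a falg2) = 0"
      by (simp add: tensor_der_mon mon_Nil tensor_bilinear flip: mon_Nil_Nil)
    then show ?case by (simp add: mon_Nil coprod_one) (simp add: coprod_def alg_ext_def)
  next
    case (Cons a w)
    have "mon (a # w) = mon [a] * mon w" by (simp flip: mon_append)
    moreover have "tensor_der (der_ext f) (coprod (mon [a])) = coprod (f a)"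
      using assms[of a] by (simp add: tensor_der_der_ext_letter primitives_def)
    ultimately show ?case
      by (simp add: coprod_mult tensor_der_der_ext_mult Cons der_ext_mult coprod_add)
  qed
  with step show ?case
    by (simp add: coprod_add coprod_scale tensor_der_add tensor_der_scale)
      (simp add: der_ext_def lin_ext_add lin_ext_scale coprod_add coprod_scale)
qed

section \<open>The stabilizer in terms of primitive elements\<close>

lemma pi_Y_add: "pi_Y (p + q) = pi_Y p + pi_Y q"
  by (simp add: pi_Y_def lin_ext_add)

lemma pi_Y_scale: "pi_Y (c *\<^sub>Q p) = c *\<^sub>Q pi_Y p"
  by (simp add: pi_Y_def lin_ext_scale)

lemma pi_Y_zero [simp]: "pi_Y 0 = 0"
  by (simp add: pi_Y_def)

lemma pi_Y_diff: "pi_Y (p - q) = pi_Y p - pi_Y q"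
  by (metis add_diff_cancel diff_add_cancel pi_Y_add)

lemma pi_Y_mon_xword: "pi_Y (mon (xword ks)) = mon ks"
  using pi_Y_word[of ks 0] by simp

lemma xword_append: "xword (ks @ js) = xword ks @ xword js"
  by (simp add: xword_def)

lemma coef_pi_Y: "coef (pi_Y p) ks = coef p (xword ks)"
proof (induction p rule: qspan_induct)
  case (step c w p)
  obtain js r where w: "w = xword js @ replicate r X0" using xword_cases by blast
  have "w = xword ks \<longleftrightarrow> r = 0 \<and> js = ks"
    using yword_xword[of js r] yword_xword[of ks 0] by (auto simp: w split: if_splits)
  then have "coef (pi_Y (mon w)) ks = coef (mon w) (xword ks)"
    by (auto simp: w pi_Y_word coef_mon)
  with step show ?case by (simp add: pi_Y_add pi_Y_scale lookup_add)
qed simp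

lemma pi_Y_xword_mult: "pi_Y (mon (xword ks) * q) = mon ks * pi_Y q"
proof (induction q rule: qspan_induct)
  case (step c w q)
  obtain js r where w: "w = xword js @ replicate r X0" using xword_cases by blast
  have eq: "mon (xword ks) * mon w = mon (xword (ks @ js) @ replicate r X0)"
    by (simp add: w xword_append flip: mon_append)
  have "pi_Y (mon (xword ks) * mon w) = mon ks * pi_Y (mon w)"
    unfolding eq pi_Y_word unfolding w pi_Y_word by (simp add: mon_append)
  with step show ?case by (simp add: pi_Y_add pi_Y_scale distrib_left qscale_mult_right)
qed simp

text \<open>\<open>pi_Y\<close> is not multiplicative in general, but it is when the left factor
  ends in x1, since words ending in x1 are values of \<open>xword\<close>.\<close>

lemma pi_Y_x1_mult: "pi_Y (q * x1 * r) = pi_Y (q * x1) * pi_Y r"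
proof (induction q rule: qspan_induct)
  case (step c w q)
  obtain js n where w: "w = xword js @ replicate n X0" using xword_cases by blast
  have "mon w * x1 = mon (xword (js @ [Y n]))"
    by (simp add: w xword_append xword_def flip: mon_append)
  then have "pi_Y (mon w * x1 * r) = pi_Y (mon w * x1) * pi_Y r"
    by (simp add: pi_Y_xword_mult pi_Y_mon_xword)
  with step show ?case by (simp add: pi_Y_add pi_Y_scale distrib_right qscale_mult_left)
qed simp

definition yder :: "xletter falg \<Rightarrow> yletter \<Rightarrow> yletter falg" where
  "yder \<psi> k = (case k of Y m \<Rightarrow>
     pi_Y (\<psi> * mon (replicate m X0) * x1 - mon (replicate m X0) * \<psi> * x1))"

text \<open>On \<open>X\<close>, the operator \<open>s_op \<psi>\<close> minus right multiplication by \<open>\<psi>\<close> is the derivation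
  with $x_0 \mapsto [\psi, x_0]$ and $x_1 \mapsto 0$. It preserves the subalgebra generated by the
  words $x_0^m x_1$, so it descends to the derivation of the $Y$-algebra with values \<open>yder \<psi>\<close>.\<close>

lemma sY_op_eq: "sY_op \<psi> q = q * pi_Y \<psi> + der_ext (yder \<psi>) q"
proof -
  define D where "D q = \<psi> * q - q * \<psi> + d_der \<psi> q" for q
  have D_mult: "D (p * q) = D p * q + p * D q" for p q
    by (simp add: D_def d_der_def der_ext_mult algebra_simps)
  have d_x0: "d_der \<psi> (mon (replicate m X0)) = 0" for m
    by (induction m) (simp_all add: d_der_def der_ext_def)
  have D_letter: "D (mon (xword [Y m]))
      = (\<psi> * mon (replicate m X0) - mon (replicate m X0) * \<psi>) * x1" for m
  proof -
    have "mon (xword [Y m]) = mon (replicate m X0) * x1"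
      by (simp add: xword_def flip: mon_append)
    moreover have "d_der \<psi> x1 = x1 * \<psi> - \<psi> * x1" by (simp add: d_der_def)
    ultimately show ?thesis
      using d_x0[of m] by (simp add: D_def) (simp add: d_der_def der_ext_mult algebra_simps)
  qed
  \<comment> \<open>By \<open>D_letter\<close>, \<open>D (mon (xword [k]))\<close> ends in x1, so
    \<open>pi_Y\<close> is multiplicative on both terms of the Leibniz rule.\<close>
  have piD: "pi_Y (D (mon (xword ks))) = der_word (yder \<psi>) ks" for ks
  proof (induction ks)
    case Nil
    show ?case by (simp add: xword_def mon_Nil D_def d_der_def)
  next
    case (Cons k ks)
    obtain m where k: "k = Y m" by (cases k)
    have "mon (xword (k # ks)) = mon (xword [k]) * mon (xword ks)"
      using xword_append[of "[k]" ks] by (simp flip: mon_append)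
    then have "pi_Y (D (mon (xword (k # ks))))
        = pi_Y (D (mon (xword [k]))) * pi_Y (mon (xword ks)) + mon [k] * pi_Y (D (mon (xword ks)))"
      by (simp add: D_mult pi_Y_add pi_Y_xword_mult k D_letter pi_Y_x1_mult)
    then show ?case
      by (simp add: Cons pi_Y_mon_xword k D_letter yder_def algebra_simps)
  qed
  have "sY_op \<psi> = (\<lambda>q. q * pi_Y \<psi> + der_ext (yder \<psi>) q)"
  proof (rule linear_eqI)
    show "qlinear (sY_op \<psi>)" by (rule sY_op_spec)
    show "qlinear (\<lambda>q. q * pi_Y \<psi> + der_ext (yder \<psi>) q)"
      by (rule Vector_Spaces.linear.intro; unfold_locales)
        (simp_all add: distrib_right qscale_mult_left der_ext_def lin_ext_add lin_ext_scale
          QV.scale_right_distrib)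
    fix ks
    have "sY_op \<psi> (mon ks) = pi_Y (s_op \<psi> (mon (xword ks)))"
      using fun_cong[OF sY_op_spec(2)[of \<psi>], of "mon (xword ks)"] by (simp add: pi_Y_mon_xword)
    also have "s_op \<psi> (mon (xword ks)) = mon (xword ks) * \<psi> + D (mon (xword ks))"
      by (simp add: s_op_def D_def)
    finally show "sY_op \<psi> (mon ks) = mon ks * pi_Y \<psi> + der_ext (yder \<psi>) (mon ks)"
      by (simp add: pi_Y_add pi_Y_xword_mult piD der_ext_def)
  qed
  then show ?thesis by simp
qed

lemma stab_iff:
  "\<psi> \<in> stab_Delta_Y \<longleftrightarrow>
    \<psi> \<in> LieX \<and> pi_Y \<psi> \<in> primitives \<and> (\<forall>m. yder \<psi> (Y m) \<in> primitives)"
proof -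
  let ?E = "der_ext (yder \<psi>)"
  have sY: "sY_op \<psi> = (\<lambda>q. q * pi_Y \<psi> + ?E q)" by (rule ext) (rule sY_op_eq)
  have stab: "\<psi> \<in> stab_Delta_Y \<longleftrightarrow> \<psi> \<in> LieX \<and>
      (\<forall>q. tensor_der (\<lambda>q. q * pi_Y \<psi>) (coprod q) + tensor_der ?E (coprod q)
        = coprod (q * pi_Y \<psi>) + coprod (?E q))"
    unfolding stab_Delta_Y_def
    by (simp add: fun_eq_iff flip: tensor_der_def)
      (simp add: sY tensor_der_plus coprod_add)
  show ?thesis
  proof
    assume "\<psi> \<in> stab_Delta_Y"
    then have L: "\<psi> \<in> LieX" and eq: "\<And>q. tensor_der (\<lambda>q. q * pi_Y \<psi>) (coprod q) + tensor_der ?E (coprod q)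
        = coprod (q * pi_Y \<psi>) + coprod (?E q)"
      by (simp_all add: stab)
    \<comment> \<open>At q = 1 the derivation vanishes on both sides, which isolates the condition
      on \<open>pi_Y \<psi>\<close>.\<close>
    have "tensor_der ?E (1 :: yletter falg2) = 0"
      by (simp add: tensor_der_mon mon_Nil tensor_bilinear flip: mon_Nil_Nil)
    moreover have "coprod (0 :: yletter falg) = 0" by (simp add: coprod_def alg_ext_def)
    ultimately have p: "pi_Y \<psi> \<in> primitives"
      using eq[of 1] by (simp add: coprod_one tensor_der_right_mult primitives_def)
    \<comment> \<open>The right multiplication terms now cancel in the identity at a letter.\<close>
    have "yder \<psi> (Y m) \<in> primitives" for m
      using eq[of "mon [Y m]"]
      by (simp add: coderivation_right_mult[OF p] tensor_der_der_ext_letter primitives_def)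
    with L p show "\<psi> \<in> LieX \<and> pi_Y \<psi> \<in> primitives \<and> (\<forall>m. yder \<psi> (Y m) \<in> primitives)" by blast
  next
    assume *: "\<psi> \<in> LieX \<and> pi_Y \<psi> \<in> primitives \<and> (\<forall>m. yder \<psi> (Y m) \<in> primitives)"
    then have "yder \<psi> k \<in> primitives" for k by (cases k) simp
    with * show "\<psi> \<in> stab_Delta_Y"
      by (simp add: stab coderivation_right_mult coderivation_der_ext)
  qed
qed

lemma subspace_stab: "QV.subspace stab_Delta_Y"
proof -
  have add: "yder (p + q) (Y m) = yder p (Y m) + yder q (Y m)" for p q m
    by (simp add: yder_def distrib_left distrib_right flip: pi_Y_add) (simp add: algebra_simps)
  have scale: "yder (c *\<^sub>Q p) (Y m) = c *\<^sub>Q yder p (Y m)" for c p m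
    by (simp add: yder_def qscale_mult_left qscale_mult_right flip: pi_Y_scale QV.scale_right_diff_distrib)
  have zero: "yder 0 (Y m) = 0" for m by (simp add: yder_def)
  show ?thesis
    by (intro QV.subspaceI) (simp_all add: stab_iff add scale zero pi_Y_add pi_Y_scale
      QV.subspace_0[OF subspace_primitives] QV.subspace_add[OF subspace_primitives]
      QV.subspace_scale[OF subspace_primitives])
qed


section \<open>Words encoded by their gaps\<close>

text \<open>A word of depth d is encoded by its d + 1 runs of x0. The value at [] is a convention:
  [] and [0] both encode the empty word.\<close>

fun gaps :: "nat list \<Rightarrow> xletter list" where
  "gaps [] = []"
| "gaps [a] = replicate a X0"
| "gaps (a # b # l) = replicate a X0 @ X1 # gaps (b # l)"

lemma gaps_Cons: "l \<noteq> [] \<Longrightarrow> gaps (a # l) = replicate a X0 @ X1 # gaps l"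
  by (cases l) auto

lemma gaps_snoc: "l \<noteq> [] \<Longrightarrow> gaps (l @ [a]) = gaps l @ X1 # replicate a X0"
proof (induction l rule: gaps.induct)
  case (3 a b l)
  then show ?case by simp
qed simp_all

lemma rev_gaps: "rev (gaps l) = gaps (rev l)"
proof (induction l rule: gaps.induct)
  case (3 a b l)
  then show ?case using gaps_snoc[of "rev (b # l)" a] by simp
qed simp_all

lemma xword_gaps: "l \<noteq> [] \<Longrightarrow> xword (map Y l) = gaps l @ [X1]"
  by (induction l rule: gaps.induct) (auto simp: xword_def)

text \<open>Words whose last run is empty are those that survive \<open>pi_Y\<close>, so the
  coefficients with last entry 0 are those of the Y side.\<close>

lemma gaps_snoc_zero: "gaps (l @ [0]) = xword (map Y l)"
  by (cases "l = []") (auto simp: gaps_snoc xword_gaps, simp add: xword_def)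

lemma length_gaps: "length (gaps (k # l)) = k + sum_list l + length l"
  by (induction l arbitrary: k) auto

lemma gaps_eq_Nil_iff: "gaps l = [] \<longleftrightarrow> l = [] \<or> l = [0]"
  by (induction l rule: gaps.induct) auto

lemma ex_map_Y: "\<exists>l. ks = map Y l"
proof
  show "ks = map Y (map (case_yletter id) ks)"
    by (induction ks) (auto split: yletter.split)
qed

text \<open>In terms of generating series, \<open>raise\<close> is the operator $\sum_i \partial/\partial z_i$.\<close>

fun raise :: "(nat list \<Rightarrow> rat) \<Rightarrow> nat list \<Rightarrow> rat" where
  "raise f [] = 0"
| "raise f (a # l) = of_nat (Suc a) * f (Suc a # l) + raise (\<lambda>w. f (a # w)) l"

lemma raise_cong: "(\<And>w. length w = length l \<Longrightarrow> f w = g w) \<Longrightarrow> raise f l = raise g l"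
proof (induction l arbitrary: f g)
  case (Cons a l)
  have "raise (\<lambda>w. f (a # w)) l = raise (\<lambda>w. g (a # w)) l"
    by (rule Cons.IH) (rule Cons.prems, simp)
  moreover have "f (Suc a # l) = g (Suc a # l)" by (rule Cons.prems) simp
  ultimately show ?case by simp
qed simp

lemma raise_add: "raise (\<lambda>w. f w + g w) l = raise f l + raise g l"
  by (induction l arbitrary: f g) (auto simp: algebra_simps)

lemma raise_zero [simp]: "raise (\<lambda>w. 0) l = 0"
  by (induction l) auto

lemma raise_snoc: "raise f (l @ [k]) = raise (\<lambda>w. f (w @ [k])) l + of_nat (Suc k) * f (l @ [Suc k])"
  by (induction l arbitrary: f) auto

text \<open>Each entry of a shuffle comes from \<open>u\<close> or from \<open>v\<close>, and
  \<open>raise\<close> changes one entry at a time; hence a Leibniz rule.\<close>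

lemma shsum_raise:
  "shsum (raise f) u v = raise (\<lambda>x. shsum f x v) u + raise (\<lambda>y. shsum f u y) v"
proof (induction "length u + length v" arbitrary: f u v rule: less_induct)
  case less
  show ?case
  proof (cases u)
    case u: (Cons a u')
    show ?thesis
    proof (cases v)
      case v: (Cons b v')
      have 1: "shsum (raise (\<lambda>w. f (a # w))) u' v
          = raise (\<lambda>x. shsum (\<lambda>w. f (a # w)) x v) u' + raise (\<lambda>y. shsum (\<lambda>w. f (a # w)) u' y) v"
        by (rule less) (simp add: u)
      have 2: "shsum (raise (\<lambda>w. f (b # w))) u v'
          = raise (\<lambda>x. shsum (\<lambda>w. f (b # w)) x v') u + raise (\<lambda>y. shsum (\<lambda>w. f (b # w)) u y) v'"
        by (rule less) (simp add: v)
      show ?thesis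
        using 1 2 by (simp add: u v shsum_add shsum_scale raise_add algebra_simps)
    qed simp
  next
    case Nil
    moreover have "shsum f [] = f" by (rule ext) simp
    ultimately show ?thesis by simp
  qed
qed

section \<open>Shuffling a word with the letter x0\<close>

lemma shsum_x0_replicate:
  "shsum g [X0] (replicate a X0) = of_nat (Suc a) * g (replicate (Suc a) X0)"
  by (induction a arbitrary: g) (auto simp: algebra_simps)

lemma shsum_x0_block:
  "shsum g [X0] (replicate a X0 @ X1 # v)
    = of_nat (Suc a) * g (replicate (Suc a) X0 @ X1 # v)
      + shsum (\<lambda>w. g (replicate a X0 @ X1 # w)) [X0] v"
  by (induction a arbitrary: g) (auto simp: algebra_simps)

text \<open>A run of length a offers a + 1 places for x0, all with the same result; these are the
  weights in \<open>raise\<close>.\<close>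

lemma shsum_x0_gaps: "l \<noteq> [] \<Longrightarrow> shsum g [X0] (gaps l) = raise (\<lambda>w. g (gaps w)) l"
proof (induction l arbitrary: g rule: gaps.induct)
  case (2 a)
  show ?case by (simp add: shsum_x0_replicate)
next
  case (3 a b l)
  have "raise (\<lambda>w. g (gaps (a # w))) (b # l)
      = raise (\<lambda>w. g (replicate a X0 @ X1 # gaps w)) (b # l)"
    by (rule raise_cong) (auto simp: gaps_Cons simp flip: length_greater_0_conv)
  then show ?case
    using 3 by (simp add: shsum_x0_block del: raise.simps(2)) (simp add: raise.simps(2)[of _ a])
qed simp

section \<open>Coefficients of the derivation on letters\<close>

lemma coef_mult_x0_power:
  "coef (p * mon (replicate m X0)) (gaps (l @ [k])) = (if m \<le> k then coef p (gaps (l @ [k - m])) else 0)"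
proof (cases "m \<le> k")
  case True
  then have "gaps (l @ [k]) = gaps (l @ [k - m]) @ replicate m X0"
    by (cases "l = []") (simp_all add: gaps_snoc flip: replicate_add)
  with True show ?thesis by (simp add: coef_mult_mon_list)
next
  case False
  have "gaps (l @ [k]) \<noteq> x @ replicate m X0" for x
  proof
    assume *: "gaps (l @ [k]) = x @ replicate m X0"
    show False
    proof (cases "l = []")
      case True
      with * have "length (replicate k X0) = length (x @ replicate m X0)" by simp
      with False show False by simp
    next
      case l: False
      \<comment> \<open>As k < m, this position holds X1 on the left and lies in the trailing run of
        X0 on the right.\<close>
      from * l have "(gaps l @ X1 # replicate k X0) ! (length (gaps l)) = (x @ replicate m X0) ! (length (gaps l))"
        and "length (gaps l @ X1 # replicate k X0) = length (x @ replicate m X0)"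
        by (simp_all add: gaps_snoc)
      with False show False by (simp add: nth_append)
    qed
  qed
  with False show ?thesis by (simp add: coef_mult_mon_eq_0 plus_list_def)
qed

lemma coef_x0_power_mult:
  "coef (mon (replicate m X0) * p) (gaps (k # l)) = (if m \<le> k then coef p (gaps ((k - m) # l)) else 0)"
proof (cases "m \<le> k")
  case True
  then have "gaps (k # l) = replicate m X0 @ gaps ((k - m) # l)"
    by (cases "l = []") (simp_all add: gaps_Cons flip: replicate_add append_assoc)
  with True show ?thesis by (simp add: coef_mon_mult_list)
next
  case False
  have "gaps (k # l) \<noteq> replicate m X0 @ x" for x
  proof
    assume *: "gaps (k # l) = replicate m X0 @ x"
    show False
    proof (cases "l = []")
      case True
      with * have "length (replicate k X0) = length (replicate m X0 @ x)" by simp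
      with False show False by simp
    next
      case l: False
      from * l have "(replicate k X0 @ X1 # gaps l) ! k = (replicate m X0 @ x) ! k"
        by (simp add: gaps_Cons)
      with False show False by (simp add: nth_append)
    qed
  qed
  with False show ?thesis by (simp add: coef_mon_mult_eq_0 plus_list_def)
qed

text \<open>The factor x1 cancels the final x1 of the code word. The two halves of the commutator
  with x0^m then lower the last or the first entry by m.\<close>

lemma coef_yder:
  assumes "l \<noteq> []"
  shows "coef (yder \<psi> (Y m)) (map Y l)
    = (if m \<le> last l then coef \<psi> (gaps (butlast l @ [last l - m])) else 0)
      - (if m \<le> hd l then coef \<psi> (gaps ((hd l - m) # tl l)) else 0)"
proof -
  have "coef (yder \<psi> (Y m)) (map Y l)
      = coef (\<psi> * mon (replicate m X0)) (gaps l) - coef (mon (replicate m X0) * \<psi>) (gaps l)"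
    using assms by (simp add: yder_def coef_pi_Y lookup_minus xword_gaps coef_mult_mon_list)
  then show ?thesis
    using assms coef_mult_x0_power[of \<psi> m "butlast l" "last l"] coef_x0_power_mult[of m \<psi> "hd l" "tl l"]
    by simp
qed

lemma coef_yder_Nil: "coef (yder \<psi> (Y m)) [] = 0"
proof -
  have "coef (q * x1) [] = 0" for q
    by (rule coef_mult_mon_eq_0) (simp add: plus_list_def)
  then show ?thesis by (simp add: yder_def coef_pi_Y lookup_minus xword_def)
qed


section \<open>Cyclic symmetry of linearized double shuffle solutions\<close>

lemma ls_iff:
  "\<psi> \<in> ls \<longleftrightarrow> coef \<psi> [X0] = 0 \<and> coef \<psi> [X1] = 0 \<and> \<psi> \<in> LieX \<and> pi_Y \<psi> \<in> primitives \<and>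
    (\<forall>n\<ge>2. even n \<longrightarrow> coef \<psi> (replicate (n - 1) X0 @ [X1]) = 0)"
  by (simp add: ls_def primitives_def)

locale ls_element =
  fixes \<psi> :: "xletter falg"
  assumes in_ls: "\<psi> \<in> ls"
begin

definition gcoef :: "nat list \<Rightarrow> rat" where
  "gcoef l = coef \<psi> (gaps l)"

lemma alternal_coef: "alternal (coef \<psi>)"
  using in_ls by (simp add: ls_iff flip: primitives_iff_alternal)

lemma raise_gcoef:
  assumes "l \<noteq> []"
  shows "raise gcoef l = 0"
proof (cases "gaps l = []")
  case True
  \<comment> \<open>The empty word gives no shuffle relation; the claim is here that the coefficient
    of x0 vanishes, which is part of \<open>ls\<close>.\<close>
  with assms have "l = [0]" by (simp add: gaps_eq_Nil_iff)
  with in_ls show ?thesis by (simp add: gcoef_def ls_iff)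
next
  case False
  then have "shsum (coef \<psi>) [X0] (gaps l) = 0"
    by (intro alternal_shsum[OF alternal_coef]) simp_all
  with assms show ?thesis by (simp add: shsum_x0_gaps gcoef_def[abs_def])
qed

lemma gcoef_snoc_Suc: "gcoef (l @ [Suc k]) = - (1 / of_nat (Suc k)) * raise (\<lambda>w. gcoef (w @ [k])) l"
proof -
  have "raise (\<lambda>w. gcoef (w @ [k])) l + of_nat (Suc k) * gcoef (l @ [Suc k]) = 0"
    using raise_gcoef[of "l @ [k]"] by (simp add: raise_snoc)
  moreover have "of_nat (Suc k) \<noteq> (0 :: rat)" by (rule of_nat_neq_0)
  ultimately show ?thesis by (simp add: field_simps del: of_nat_Suc)
qed

text \<open>For k = 0 this is primitivity of \<open>pi_Y \<psi>\<close>. Passing to k + 1 applies a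
  multiple of \<open>raise\<close>, which preserves shuffle relations by its Leibniz rule and is 0
  at [].\<close>

lemma alternal_gcoef_snoc: "alternal (\<lambda>l. gcoef (l @ [k]))"
proof (induction k)
  case 0
  have Y: "alternal (coef (pi_Y \<psi>))"
    using in_ls by (simp add: ls_iff flip: primitives_iff_alternal)
  have "(\<lambda>l. gcoef (l @ [0])) = (\<lambda>l. coef (pi_Y \<psi>) (map Y l))"
    by (simp add: fun_eq_iff gcoef_def gaps_snoc_zero coef_pi_Y)
  with Y show ?case by (simp add: alternal_def flip: shsum_map)
next
  case (Suc k)
  let ?g = "\<lambda>l. gcoef (l @ [k])"
  have "shsum (raise ?g) u v = 0" if "u \<noteq> []" "v \<noteq> []" for u v
  proof -
    have "raise (\<lambda>x. shsum ?g x v) u = raise (\<lambda>x. 0) u"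
      using that by (intro raise_cong alternal_shsum[OF Suc]) auto
    moreover have "raise (\<lambda>y. shsum ?g u y) v = raise (\<lambda>y. 0) v"
      using that by (intro raise_cong alternal_shsum[OF Suc]) auto
    ultimately show ?thesis by (simp add: shsum_raise)
  qed
  then have "alternal (raise ?g)" by (simp add: alternal_def)
  from alternal_scale[OF this, of "- (1 / of_nat (Suc k))"] show ?case
    by (simp only: gcoef_snoc_Suc)
qed

text \<open>Reversing the X-word of \<open>k # w\<close>, or only the entries \<open>w\<close> in
  front of the base entry \<open>k\<close>, leads to the same coefficient. The antipode signs differ
  by (-1) to the number of letters x0.\<close>

lemma gcoef_rotate: "gcoef (w @ [k]) = (-1) ^ (k + sum_list w) * gcoef (k # w)"
proof -
  have "gcoef (rev w @ [k]) = - ((-1) ^ length w) * gcoef (w @ [k])"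
    by (rule alternal_rev[OF alternal_gcoef_snoc])
  moreover have "gcoef (rev (k # w)) = - ((-1) ^ (k + sum_list w + length w)) * gcoef (k # w)"
    using alternal_rev[OF alternal_coef, of "gaps (k # w)"]
    by (simp add: gcoef_def rev_gaps length_gaps)
  ultimately show ?thesis
    by (simp add: power_add)
qed

text \<open>For odd total gap the coefficients change sign under rotation. Inserting $z_0$ in all
  positions of the cyclic word $(z_1, \dots, z_d)$ gives a shuffle relation based at $z_d$ and
  another one based at $z_1$; the signs make their sum equal to twice one coefficient.\<close>

lemma gcoef_odd: "odd (sum_list l) \<Longrightarrow> gcoef l = 0"
proof -
  assume odd: "odd (sum_list l)"
  consider (0) "l = []" | (1) a where "l = [a]" | (2) a b where "l = [a, b]"
    | (3) a b v d where "l = a # b # v @ [d]"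
    by (metis append_Cons append_Nil list.exhaust rev_exhaust)
  then show ?thesis
  proof cases
    case 0
    with odd show ?thesis by simp
  next
    case 1
    with alternal_Nil[OF alternal_gcoef_snoc[of a]] show ?thesis by simp
  next
    case 2
    have "odd (a + b) \<Longrightarrow> gcoef [a, b] = 0" for a b
    proof (induction b arbitrary: a)
      case 0
      have "\<forall>n\<ge>2. even n \<longrightarrow> coef \<psi> (replicate (n - 1) X0 @ [X1]) = 0"
        using in_ls by (simp add: ls_iff)
      \<comment> \<open>Here a is odd, so x0^a x1 has even weight a + 1.\<close>
      from this[rule_format, of "Suc a"] 0 show ?case
        by (cases a) (auto simp: gcoef_def)
    next
      case (Suc b)
      \<comment> \<open>The coefficient at [a, b + 1] is a multiple of the one at [a + 1, b], whose
        total is the same.\<close>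
      then show ?case using gcoef_snoc_Suc[of "[a]" b] Suc.IH[of "Suc a"] by simp
    qed
    with odd 2 show ?thesis by simp
  next
    case (3 a b v d)
    \<comment> \<open>\<open>?S\<close> collects the insertions of \<open>a\<close> between
      \<open>b\<close> and \<open>d\<close>; it enters the two relations with opposite
      signs.\<close>
    let ?S = "shsum (\<lambda>w. gcoef (b # w @ [d])) [a] v"
    have sum: "odd (a + b + sum_list v + d)" using odd by (simp add: 3 add_ac)
    have "shsum (\<lambda>w. gcoef (w @ [d])) [a] (b # v) = 0"
      by (rule alternal_shsum[OF alternal_gcoef_snoc]) simp_all
    then have "gcoef l + ?S = 0" by (simp add: 3)
    moreover have "shsum (\<lambda>w. gcoef (w @ [b])) [a] (v @ [d]) = 0"
      by (rule alternal_shsum[OF alternal_gcoef_snoc]) simp_all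
    then have "gcoef (v @ [d, a, b]) + shsum (\<lambda>w. gcoef (w @ [d, b])) [a] v = 0"
      using shsum_snoc[of "\<lambda>w. gcoef (w @ [b])" "[]" a v d] by simp
    \<comment> \<open>Two rotations, whose signs cancel.\<close>
    moreover have "gcoef (v @ [d, a, b]) = gcoef l"
    proof -
      have "gcoef ((v @ [d, a]) @ [b]) = - gcoef (b # v @ [d, a])"
        using sum by (subst gcoef_rotate) (simp add: add_ac)
      moreover have "gcoef ((b # v @ [d]) @ [a]) = - gcoef (a # b # v @ [d])"
        using sum by (subst gcoef_rotate) (simp add: add_ac)
      ultimately show ?thesis by (simp add: 3)
    qed
    moreover have "shsum (\<lambda>w. gcoef (w @ [d, b])) [a] v = shsum (\<lambda>w. - gcoef (b # w @ [d])) [a] v"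
    proof (rule shsum_cong)
      fix w assume "mset w = mset [a] + mset v"
      then have "sum_mset (mset w) = sum_mset (mset [a] + mset v)" by simp
      then have "sum_list w = a + sum_list v" by (simp add: sum_mset_sum_list)
      with sum have "odd (b + sum_list (w @ [d]))" by (simp add: add_ac)
      then show "gcoef (w @ [d, b]) = - gcoef (b # w @ [d])"
        using gcoef_rotate[of "w @ [d]" b] by simp
    qed
    ultimately show ?thesis by (simp add: shsum_minus)
  qed
qed

lemma gcoef_cyclic: "gcoef (k # w) = gcoef (w @ [k])"
  using gcoef_rotate[of w k] gcoef_odd[of "k # w"] by (cases "even (k + sum_list w)") simp_all

lemma yder_in_primitives: "yder \<psi> (Y m) \<in> primitives"
proof -
  \<comment> \<open>With \<open>gcoef_cyclic\<close>, the first-entry term of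
    \<open>coef_yder\<close> takes the same form \<open>g\<close> as the last-entry term, as
    \<open>shsum_last_eq_hd\<close> requires.\<close>
  define g where "g a w = (if m \<le> a then gcoef (w @ [a - m]) else 0)" for a w
  have g: "alternal (g a)" for a
    using alternal_gcoef_snoc by (simp add: g_def[abs_def] alternal_def)
  have "shsum (coef (yder \<psi> (Y m))) ks js = 0" if "ks \<noteq> []" "js \<noteq> []" for ks js
  proof -
    obtain u v where uv: "ks = map Y u" "js = map Y v" using ex_map_Y by blast
    have "shsum (\<lambda>w. coef (yder \<psi> (Y m)) (map Y w)) u v
        = shsum (\<lambda>w. g (last w) (butlast w) - g (hd w) (tl w)) u v"
    proof (rule shsum_cong)
      fix w assume "mset w = mset u + mset v"
      with that uv have "w \<noteq> []" by auto
      then show "coef (yder \<psi> (Y m)) (map Y w) = g (last w) (butlast w) - g (hd w) (tl w)"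
        by (simp add: coef_yder g_def gcoef_def flip: gcoef_cyclic[unfolded gcoef_def])
    qed
    also have "\<dots> = 0"
      using that uv shsum_last_eq_hd[of g u v, OF g] by (simp add: shsum_diff)
    finally show ?thesis by (simp add: uv shsum_map)
  qed
  then show ?thesis by (simp add: primitives_iff_alternal alternal_def coef_yder_Nil)
qed

end

section \<open>The two inclusions\<close>

lemma ls_subset_stab: "ls \<subseteq> stab_Delta_Y"
proof
  fix \<psi> assume \<psi>: "\<psi> \<in> ls"
  then interpret ls_element \<psi> by unfold_locales
  from \<psi> yder_in_primitives show "\<psi> \<in> stab_Delta_Y" by (simp add: stab_iff ls_iff)
qed

lemma stab_even_depth_one:
  assumes \<psi>: "\<psi> \<in> stab_Delta_Y" and n: "even n" "n \<ge> 2"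
  shows "coef \<psi> (replicate (n - 1) X0 @ [X1]) = 0"
proof -
  obtain m where m: "n = Suc m" "m > 0" "odd m" using n by (cases n) auto
  have "alternal (coef (yder \<psi> (Y 1)))"
    using \<psi> by (simp add: stab_iff flip: primitives_iff_alternal)
  then have "shsum (coef (yder \<psi> (Y 1))) [Y n] [Y 0] = 0"
    by (rule alternal_shsum) simp_all
  \<comment> \<open>Only the entry n can be lowered by 1, so each of the two shuffles contributes a
    single term.\<close>
  then have "coef \<psi> (gaps [0, m]) = coef \<psi> (gaps [m, 0])"
    using coef_yder[of "[n, 0]" \<psi> 1] coef_yder[of "[0, n]" \<psi> 1] m by simp
  moreover have "alternal (coef \<psi>)"
    using \<psi> by (simp add: stab_iff flip: primitives_iff_alternal)
  \<comment> \<open>The word has even length m + 1, so reversal changes the sign.\<close>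
  from alternal_rev[OF this, of "gaps [m, 0]"]
  have "coef \<psi> (gaps [0, m]) = - coef \<psi> (gaps [m, 0])"
    unfolding rev_gaps using m by simp
  ultimately show ?thesis by (simp add: m)
qed

lemma pi_Y_x0: "pi_Y x0 = 0"
  using pi_Y_word[of "[]" 1] by (simp add: xword_def)

lemma pi_Y_x1: "pi_Y x1 = mon [Y 0]"
  using pi_Y_word[of "[Y 0]" 0] by (simp add: xword_def)

lemma x0_in_stab: "x0 \<in> stab_Delta_Y"
proof -
  have "x0 * mon (replicate m X0) = mon (replicate m X0) * x0" for m
    by (simp add: replicate_append_same flip: mon_append)
  then have "yder x0 (Y m) = 0" for m by (simp add: yder_def)
  then show ?thesis
    by (simp add: stab_iff letter_in_primitives pi_Y_x0 QV.subspace_0[OF subspace_primitives])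
qed

lemma commutator_in_primitives:
  assumes "p \<in> primitives" "q \<in> primitives"
  shows "p * q - q * p \<in> primitives"
proof -
  have "coprod (p * q - q * p) = coprod p * coprod q - coprod q * coprod p"
    using coprod_add[of "p * q - q * p" "q * p"] by (simp add: coprod_mult)
  moreover have "coprod p = p \<otimes>\<^sub>Q 1 + 1 \<otimes>\<^sub>Q p" "coprod q = q \<otimes>\<^sub>Q 1 + 1 \<otimes>\<^sub>Q q"
    using assms by (simp_all add: primitives_def)
  moreover have "(r - s) \<otimes>\<^sub>Q t = r \<otimes>\<^sub>Q t - s \<otimes>\<^sub>Q t" "t \<otimes>\<^sub>Q (r - s) = t \<otimes>\<^sub>Q r - t \<otimes>\<^sub>Q s" for r s t :: "'a falg"
    by (auto intro!: poly_mapping_eqI simp: lookup_tensor lookup_minus left_diff_distrib right_diff_distrib)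
  ultimately show ?thesis
    by (simp add: primitives_def distrib_left distrib_right tensor_mult)
qed

text \<open>The element [x1, x0^m] x1 is the commutator of the letters \<open>Y 0\<close> and
  \<open>Y m\<close>, hence primitive.\<close>

lemma x1_in_stab: "x1 \<in> stab_Delta_Y"
proof -
  have "yder x1 (Y m) = mon [Y 0] * mon [Y m] - mon [Y m] * mon [Y 0]" for m
    using pi_Y_mon_xword[of "[Y 0, Y m]"] pi_Y_mon_xword[of "[Y m, Y 0]"]
    by (simp add: yder_def pi_Y_diff xword_def flip: mon_append)
  then show ?thesis
    by (simp add: stab_iff letter_in_primitives pi_Y_x1 commutator_in_primitives)
qed

lemma stab_eq:
  "stab_Delta_Y = {a + b + c | a b c. a \<in> ls \<and> b \<in> QV.span {x0} \<and> c \<in> QV.span {x1}}"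
proof (intro equalityI subsetI)
  fix \<psi> assume \<psi>: "\<psi> \<in> stab_Delta_Y"
  define b where "b = coef \<psi> [X0] *\<^sub>Q x0"
  define c where "c = coef \<psi> [X1] *\<^sub>Q x1"
  \<comment> \<open>Removing the linear part stays in the stabilizer, since x0 and x1 belong to it,
    and gives the first condition of \<open>ls\<close>.\<close>
  define a where "a = \<psi> - b - c"
  have bc: "b \<in> QV.span {x0}" "c \<in> QV.span {x1}"
    by (auto simp: b_def c_def intro: QV.span_scale QV.span_base)
  have a: "a \<in> stab_Delta_Y"
    unfolding a_def b_def c_def
    by (intro QV.subspace_diff[OF subspace_stab] QV.subspace_scale[OF subspace_stab] \<psi> x0_in_stab x1_in_stab)
  then have "a \<in> ls"
    using stab_even_depth_one[OF a]
    by (simp add: ls_iff stab_iff) (simp add: a_def b_def c_def lookup_minus coef_mon)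
  moreover have "\<psi> = a + b + c" by (simp add: a_def)
  ultimately show "\<psi> \<in> {a + b + c | a b c. a \<in> ls \<and> b \<in> QV.span {x0} \<and> c \<in> QV.span {x1}}"
    using bc by blast
next
  fix \<psi> assume "\<psi> \<in> {a + b + c | a b c. a \<in> ls \<and> b \<in> QV.span {x0} \<and> c \<in> QV.span {x1}}"
  then obtain a b c where \<psi>: "\<psi> = a + b + c" "a \<in> ls" "b \<in> QV.span {x0}" "c \<in> QV.span {x1}"
    by blast
  have "QV.span {x0} \<subseteq> stab_Delta_Y" "QV.span {x1} \<subseteq> stab_Delta_Y"
    by (simp_all add: QV.span_minimal[OF _ subspace_stab] x0_in_stab x1_in_stab)
  with \<psi> ls_subset_stab show "\<psi> \<in> stab_Delta_Y"
    by (auto intro!: QV.subspace_add[OF subspace_stab])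
qed

section \<open>The bigrading\<close>

definition bipart :: "nat \<Rightarrow> nat \<Rightarrow> xletter falg \<Rightarrow> xletter falg" where
  "bipart n d = lin_ext (\<lambda>w. if length w = n \<and> count_list w X1 = d then mon w else 0)"

lemma bipart_add: "bipart n d (p + q) = bipart n d p + bipart n d q"
  by (simp add: bipart_def lin_ext_add)

lemma bipart_scale: "bipart n d (c *\<^sub>Q p) = c *\<^sub>Q bipart n d p"
  by (simp add: bipart_def lin_ext_scale)

lemma coef_bipart:
  "coef (bipart n d p) w = (if length w = n \<and> count_list w X1 = d then coef p w else 0)"
proof (induction p rule: qspan_induct)
  case zero
  show ?case by (simp add: bipart_def)
next
  case (step c x p)
  have "coef (bipart n d (mon x)) w = (if length w = n \<and> count_list w X1 = d then coef (mon x) w else 0)"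
    by (auto simp: bipart_def coef_mon)
  with step show ?case by (simp add: bipart_add bipart_scale lookup_add)
qed

lemma bipart_in_bihomogeneous: "bipart n d p \<in> bihomogeneous n d"
  by (auto simp: bihomogeneous_def in_keys_iff coef_bipart split: if_splits)

lemma sum_bipart:
  "p = (\<Sum>(n, d)\<in>(\<lambda>w. (length w, count_list w X1)) ` Poly_Mapping.keys p. bipart n d p)"
proof (rule poly_mapping_eqI)
  fix w
  let ?b = "\<lambda>w. (length w, count_list w X1)"
  have "coef (\<Sum>(n, d)\<in>?b ` Poly_Mapping.keys p. bipart n d p) w
      = (\<Sum>i\<in>?b ` Poly_Mapping.keys p. if i = ?b w then coef p w else 0)"
    unfolding lookup_sum by (intro sum.cong) (auto simp: coef_bipart split: prod.split)
  also have "\<dots> = coef p w" by (auto simp: in_keys_iff)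
  finally show "coef p w = coef (\<Sum>(n, d)\<in>?b ` Poly_Mapping.keys p. bipart n d p) w" ..
qed

text \<open>By \<open>sum_bipart\<close> an element is the finite sum of its bihomogeneous parts, so
  closure under the projections \<open>bipart\<close> suffices.\<close>

lemma bigraded_subspace_LieXI:
  assumes "V \<subseteq> LieX" "QV.subspace V" and "\<And>n d p. p \<in> V \<Longrightarrow> bipart n d p \<in> V"
  shows "bigraded_subspace_LieX V"
  unfolding bigraded_subspace_LieX_def
proof (intro conjI equalityI subsetI)
  fix p assume "p \<in> V"
  let ?U = "\<Union>n d. V \<inter> bihomogeneous n d"
  have "bipart n d p \<in> ?U" for n d
    using assms(3)[OF \<open>p \<in> V\<close>, of n d] bipart_in_bihomogeneous[of n d p] by blast
  then have "(\<Sum>(n, d)\<in>(\<lambda>w. (length w, count_list w X1)) ` Poly_Mapping.keys p. bipart n d p)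
      \<in> QV.span ?U"
    by (intro QV.span_sum) (simp add: QV.span_base case_prod_beta)
  then show "p \<in> QV.span ?U" by (subst sum_bipart)
next
  fix p assume "p \<in> QV.span (\<Union>n d. V \<inter> bihomogeneous n d)"
  moreover have "QV.span (\<Union>n d. V \<inter> bihomogeneous n d) \<subseteq> V"
    by (rule QV.span_minimal[OF _ assms(2)]) blast
  ultimately show "p \<in> V" by blast
qed (use assms(1,2) in auto)

lemma bipart_mon: "bipart n d (mon w) = (if length w = n \<and> count_list w X1 = d then mon w else 0)"
  by (simp add: bipart_def)

lemma bipart_span_letter:
  assumes "p \<in> QV.span {mon [a]}"
  shows "bipart n d p \<in> QV.span {mon [a]}"
proof -
  obtain c where "p = c *\<^sub>Q mon [a]" using assms by (auto simp: QV.span_singleton)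
  then have "bipart n d p = c *\<^sub>Q (if length [a] = n \<and> count_list [a] X1 = d then mon [a] else 0)"
    by (simp only: bipart_scale bipart_mon)
  moreover have "(if length [a] = n \<and> count_list [a] X1 = d then mon [a] else 0) \<in> QV.span {mon [a]}"
    by (simp add: QV.span_base QV.span_zero)
  ultimately show ?thesis by (simp only: QV.span_scale)
qed

lemma bigraded_span_letter: "bigraded_subspace_LieX (QV.span {mon [a]})"
  by (rule bigraded_subspace_LieXI)
    (simp_all add: bipart_span_letter letter_in_primitives QV.span_minimal[OF _ subspace_primitives])

lemma count_list_mset_cong: "mset u = mset v \<Longrightarrow> count_list u a = count_list v a"
  by (metis count_mset)

lemma xword_mset_cong: "mset u = mset v \<Longrightarrow> mset (xword u) = mset (xword v)"
proof -
  have *: "mset (xword ks) = (\<Sum>k\<in>#mset ks. mset (xword [k]))" for ks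
    by (induction ks) (simp_all add: xword_def)
  show "mset u = mset v \<Longrightarrow> mset (xword u) = mset (xword v)"
    unfolding *[of u] *[of v] by simp
qed

text \<open>Weight and depth depend only on the content of a word, and on the Y side only on the
  multiset of letters of \<open>ks\<close>, so \<open>alternal_restrict\<close> applies to
  both.\<close>

lemma bipart_ls:
  assumes "\<psi> \<in> ls"
  shows "bipart n d \<psi> \<in> ls"
proof -
  let ?P = "\<lambda>w. length w = n \<and> count_list w X1 = d"
  have P: "?P u = ?P v" if "mset u = mset v" for u v
    using mset_eq_length[OF that] count_list_mset_cong[OF that] by simp
  have c: "coef (bipart n d \<psi>) = (\<lambda>w. if ?P w then coef \<psi> w else 0)"
    by (rule ext) (rule coef_bipart)
  have "alternal (\<lambda>w. if ?P w then coef \<psi> w else 0)"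
    by (rule alternal_restrict[OF _ P]) (use assms in \<open>simp_all add: ls_iff flip: primitives_iff_alternal\<close>)
  moreover have "alternal (\<lambda>ks. if ?P (xword ks) then coef (pi_Y \<psi>) ks else 0)"
    by (rule alternal_restrict[OF _ P[OF xword_mset_cong]])
      (use assms in \<open>simp_all add: ls_iff flip: primitives_iff_alternal\<close>)
  moreover have "coef (pi_Y (bipart n d \<psi>)) = (\<lambda>ks. if ?P (xword ks) then coef (pi_Y \<psi>) ks else 0)"
    by (rule ext) (simp add: coef_pi_Y coef_bipart)
  ultimately show ?thesis
    using assms by (auto simp: ls_iff primitives_iff_alternal c)
qed

lemma subspace_ls: "QV.subspace ls"
  by (rule QV.subspaceI)
    (simp_all add: ls_iff lookup_add pi_Y_add pi_Y_scale QV.subspace_0[OF subspace_primitives]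
      QV.subspace_add[OF subspace_primitives] QV.subspace_scale[OF subspace_primitives])

lemma bigraded_ls: "bigraded_subspace_LieX ls"
  by (rule bigraded_subspace_LieXI[OF _ subspace_ls bipart_ls]) (auto simp: ls_iff)

text \<open>The grading is inherited from the summands through \<open>stab_eq\<close>.\<close>

lemma bigraded_stab: "bigraded_subspace_LieX stab_Delta_Y"
proof (rule bigraded_subspace_LieXI[OF _ subspace_stab])
  show "stab_Delta_Y \<subseteq> LieX" by (auto simp: stab_iff)
  fix n d p assume "p \<in> stab_Delta_Y"
  then obtain a b c where "p = a + b + c" "a \<in> ls" "b \<in> QV.span {x0}" "c \<in> QV.span {x1}"
    unfolding stab_eq by blast
  then have "bipart n d p = bipart n d a + bipart n d b + bipart n d c"
    "bipart n d a \<in> ls" "bipart n d b \<in> QV.span {x0}" "bipart n d c \<in> QV.span {x1}"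
    by (simp_all add: bipart_add bipart_ls bipart_span_letter)
  then show "bipart n d p \<in> stab_Delta_Y"
    unfolding stab_eq by blast
qed

theorem theorem1p16:
  shows "bigraded_subspace_LieX stab_Delta_Y \<and>
    bigraded_subspace_LieX ls \<and>
    bigraded_subspace_LieX (QV.span {x0}) \<and>
    bigraded_subspace_LieX (QV.span {x1}) \<and>
    stab_Delta_Y = {a + b + c | a b c. a \<in> ls \<and> b \<in> QV.span {x0} \<and> c \<in> QV.span {x1}} \<and>
    (\<forall>a\<in>ls. \<forall>b\<in>QV.span {x0}. \<forall>c\<in>QV.span {x1}. a + b + c = 0 \<longrightarrow> a = 0 \<and> b = 0 \<and> c = 0)"
proof (intro conjI bigraded_stab bigraded_ls bigraded_span_letter stab_eq ballI impI)
  fix a b c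
  assume a: "a \<in> ls" and b: "b \<in> QV.span {x0}" and c: "c \<in> QV.span {x1}" and 0: "a + b + c = 0"
  obtain s t where st: "b = s *\<^sub>Q x0" "c = t *\<^sub>Q x1"
    using b c by (auto simp: QV.span_singleton)
  \<comment> \<open>Elements of \<open>ls\<close> have no linear part, so these coefficients see
    only b and c.\<close>
  have "coef (a + b + c) [X0] = s" "coef (a + b + c) [X1] = t"
    using a by (simp_all add: st lookup_add ls_iff coef_mon)
  then have "s = 0" "t = 0" by (simp_all add: 0)
  then show "b = 0" "c = 0" by (simp_all add: st)
  with 0 show "a = 0" by simp
qed

end
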